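(* \begin{enumerate} \item For any packed word $w$ of length $n$ and of maximal letter $k$, denote by $p(w)$ the set partition $\{w^{-1}(1),\ldots,w^{-1}(k)\}$ of $\{1,\ldots,n\}$. For any set partition $\varpi$, put $$W_\varpi=\sum_{w\text{ packed word},\ p(w)=\varpi}w.$$ These elements are a basis of a cocommutative Hopf subalgebra of $\mathbf{WQSym}$, denoted by $\mathbf{WSym}$. \item The linear map $\mathbf{F}_{chr}:\mathcal{H}_{\mathscr{G}}\to\mathbf{WQSym}$ defined on any indexed graph $G$ by $$\mathbf{F}_{chr}(G)=\sum_{f\in\mathbb{PVC}(G)}f(1)\cdots f(|G|)$$ is a Hopf algebra morphism from $(\mathcal{H}_{\mathscr{G}},m,\Delta)$ to $(\mathbf{WQSym},\uplus,\Delta)$. Its image is $\mathbf{WSym}$. Moreover, for every indexed graph $G$, $$\mathbf{F}_{chr}(G)=\sum_{\varpi\in\mathbb{IP}(G)}W_\varpi.$$ \end{enumerate}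
   Context: For $n\geq0$, $[n]=\{1,\ldots,n\}$. A set partition is a partition of a set $[n]$ with $n\geq0$. All vector spaces are over $\mathbb{Q}$. An indexed graph is a graph $G=(V(G),E(G))$ (with $E(G)$ a set of $2$-element subsets of $V(G)$) such that $V(G)=[n]$, $n=|G|\geq0$. For $I\subseteq[n]$ with $k$ elements, $G_{|I}$ is the indexed graph on $[k]$ obtained from the induced subgraph on $I$ by relabelling through the unique increasing bijection $I\to[k]$. For indexed graphs $G=([k],E(G))$ and $H=([l],E(H))$, $GH$ is the indexed graph with $V(GH)=[k+l]$ and $E(GH)=E(G)\sqcup\{\{x+k,y+k\}:\{x,y\}\in E(H)\}$. $\mathcal{H}_{\mathscr{G}}$ is the vector space with basis the indexed graphs, with product $m(G\otimes H)=GH$ and coproduct $\Delta(G)=\sum_{I\subseteq[n]}G_{|I}\otimes G_{|[n]\setminus I}$; it is a graded cocommutative Hopf algebra. $\mathbb{PVC}(G)$ is the set of packed valid colorings of $G$: maps $f:V(G)\to\mathbb{N}_{>0}$ such that $f(V(G))=[k]$ for some $k\geq0$ and $f(x)\neq f(y)$ for every edge $\{x,y\}$. $f(1)\cdots f(|G|)$ is viewed as a word. $\mathbb{IP}(G)$ is the set of partitions $\{I_1,\ldots,I_k\}$ of $V(G)$ such that each $I_p$ is an independent subset, i.e. contains no edge of $G$. A word $w$ with letters in $\mathbb{N}_{>0}$ is packed if its set of letters is $[k]$ for some $k\geq0$ (then $\max(w)=k$). For a word $w=x_1\cdots x_n$ viewed as a map $i\mapsto x_i$, $w^{-1}(j)$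 is the set of positions of the letter $j$. For any word $w$ in $\mathbb{N}_{>0}$, $\mathrm{Pack}(w)$ is obtained by applying to its letters the unique increasing bijection from its set of letters to some $[l]$. For $I\subseteq\mathbb{N}_{>0}$, $w_{|I}$ is the word obtained by keeping only the letters of $w$ belonging to $I$. $\mathbf{WQSym}$ is the vector space with basis the packed words, with product, for packed words $w$ of length $k$ and $w'$ of length $l$, $$w\uplus w'=\sum_{\substack{w''=w''_1\cdots w''_{k+l}\text{ packed},\\ \mathrm{Pack}(w''_1\cdots w''_k)=w,\ \mathrm{Pack}(w''_{k+1}\cdots w''_{k+l})=w'}}w'',$$ and coproduct $$\Delta(w)=\sum_{i=0}^{\max(w)}w_{|[i]}\otimes\mathrm{Pack}\big(w_{|[\max(w)]\setminus[i]}\big).$$ $(\mathbf{WQSym},\uplus,\Delta)$ is a Hopf algebra (unit: the empty word). *)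

theory Defs
  imports Complex_Main "HOL-Library.Poly_Mapping" "HOL-Library.Disjoint_Sets" "HOL-Library.FuncSet"
begin

text \<open>
  The rational vector space with basis \<open>'a\<close> is the type \<^typ>\<open>'a \<Rightarrow>\<^sub>0 rat\<close> of finitely supported
  functions. The tensor product of the spaces with bases \<open>'a\<close> and \<open>'b\<close> is the space with
  basis \<open>'a \<times> 'b\<close>.
\<close>

definition qscale :: "rat \<Rightarrow> ('a \<Rightarrow>\<^sub>0 rat) \<Rightarrow> ('a \<Rightarrow>\<^sub>0 rat)" where
  "qscale c x = Poly_Mapping.map ((*) c) x"

lemma lookup_qscale [simp]: "Poly_Mapping.lookup (qscale c x) a = c * Poly_Mapping.lookup x a"
  by (simp add: qscale_def Poly_Mapping.map.rep_eq when_def)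

interpretation qvec: vector_space "qscale :: rat \<Rightarrow> ('a \<Rightarrow>\<^sub>0 rat) \<Rightarrow> ('a \<Rightarrow>\<^sub>0 rat)"
  by unfold_locales (auto intro!: poly_mapping_eqI simp: lookup_add algebra_simps)

abbreviation qlinear :: "(('a \<Rightarrow>\<^sub>0 rat) \<Rightarrow> ('b \<Rightarrow>\<^sub>0 rat)) \<Rightarrow> bool" where
  "qlinear \<equiv> Vector_Spaces.linear qscale qscale"

definition bvec :: "'a \<Rightarrow> ('a \<Rightarrow>\<^sub>0 rat)" where
  "bvec a = Poly_Mapping.single a 1"

definition lin_ext :: "('a \<Rightarrow> ('b \<Rightarrow>\<^sub>0 rat)) \<Rightarrow> ('a \<Rightarrow>\<^sub>0 rat) \<Rightarrow> ('b \<Rightarrow>\<^sub>0 rat)" where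
  "lin_ext f x = (\<Sum>a\<in>Poly_Mapping.keys x. qscale (Poly_Mapping.lookup x a) (f a))"

definition tens :: "('a \<Rightarrow>\<^sub>0 rat) \<Rightarrow> ('b \<Rightarrow>\<^sub>0 rat) \<Rightarrow> ('a \<times> 'b \<Rightarrow>\<^sub>0 rat)" (infixr "\<otimes>" 70) where
  "x \<otimes> y = lin_ext (\<lambda>a. lin_ext (\<lambda>b. bvec (a, b)) y) x"

lemma lookup_tens:
  "Poly_Mapping.lookup (x \<otimes> y) (a, b) = Poly_Mapping.lookup x a * Poly_Mapping.lookup y b"
proof -
  have inner: "Poly_Mapping.lookup (lin_ext (\<lambda>b. bvec (c, b)) y) (a, b) =
      (if c = a then Poly_Mapping.lookup y b else 0)" for c :: 'a
  proof -
    have "Poly_Mapping.lookup (lin_ext (\<lambda>b. bvec (c, b)) y) (a, b) =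
        (\<Sum>d\<in>Poly_Mapping.keys y. if d = b then (if c = a then Poly_Mapping.lookup y d else 0) else 0)"
      unfolding lin_ext_def lookup_sum
      by (intro sum.cong refl) (auto simp: bvec_def lookup_single when_def)
    then show ?thesis by (simp add: sum.delta in_keys_iff)
  qed
  have "Poly_Mapping.lookup (x \<otimes> y) (a, b) =
      (\<Sum>c\<in>Poly_Mapping.keys x. Poly_Mapping.lookup x c *
         Poly_Mapping.lookup (lin_ext (\<lambda>b. bvec (c, b)) y) (a, b))"
    by (simp add: tens_def lin_ext_def[of _ x] lookup_sum)
  also have "\<dots> = (\<Sum>c\<in>Poly_Mapping.keys x.
      if c = a then Poly_Mapping.lookup x c * Poly_Mapping.lookup y b else 0)"
    by (intro sum.cong refl) (simp add: inner)
  also have "\<dots> = Poly_Mapping.lookup x a * Poly_Mapping.lookup y b"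
    by (simp add: sum.delta in_keys_iff)
  finally show ?thesis .
qed

definition tmap :: "(('a \<Rightarrow>\<^sub>0 rat) \<Rightarrow> ('c \<Rightarrow>\<^sub>0 rat)) \<Rightarrow> (('b \<Rightarrow>\<^sub>0 rat) \<Rightarrow> ('d \<Rightarrow>\<^sub>0 rat)) \<Rightarrow>
    ('a \<times> 'b \<Rightarrow>\<^sub>0 rat) \<Rightarrow> ('c \<times> 'd \<Rightarrow>\<^sub>0 rat)" where
  "tmap f g = lin_ext (\<lambda>(a, b). f (bvec a) \<otimes> g (bvec b))"

definition tswap :: "('a \<times> 'b \<Rightarrow>\<^sub>0 rat) \<Rightarrow> ('b \<times> 'a \<Rightarrow>\<^sub>0 rat)" where
  "tswap = lin_ext (\<lambda>(a, b). bvec (b, a))"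

definition tassoc :: "(('a \<times> 'b) \<times> 'c \<Rightarrow>\<^sub>0 rat) \<Rightarrow> ('a \<times> ('b \<times> 'c) \<Rightarrow>\<^sub>0 rat)" where
  "tassoc = lin_ext (\<lambda>((a, b), c). bvec (a, (b, c)))"

definition tmiddle :: "(('a \<times> 'b) \<times> ('c \<times> 'd) \<Rightarrow>\<^sub>0 rat) \<Rightarrow> (('a \<times> 'c) \<times> ('b \<times> 'd) \<Rightarrow>\<^sub>0 rat)" where
  "tmiddle = lin_ext (\<lambda>((a, b), (c, d)). bvec ((a, c), (b, d)))"

definition is_basis_of :: "'i set \<Rightarrow> ('i \<Rightarrow> ('a \<Rightarrow>\<^sub>0 rat)) \<Rightarrow> ('a \<Rightarrow>\<^sub>0 rat) set \<Rightarrow> bool" where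
  "is_basis_of I v U \<longleftrightarrow> inj_on v I \<and> qvec.independent (v ` I) \<and> qvec.span (v ` I) = U"


record 'a hopf =
  hmult :: "('a \<times> 'a \<Rightarrow>\<^sub>0 rat) \<Rightarrow> ('a \<Rightarrow>\<^sub>0 rat)"
  hunit :: "'a \<Rightarrow>\<^sub>0 rat"
  hcomult :: "('a \<Rightarrow>\<^sub>0 rat) \<Rightarrow> ('a \<times> 'a \<Rightarrow>\<^sub>0 rat)"
  hcounit :: "('a \<Rightarrow>\<^sub>0 rat) \<Rightarrow> rat"

definition is_algebra :: "'a hopf \<Rightarrow> bool" where
  "is_algebra H \<longleftrightarrow> qlinear (hmult H) \<and>
     (\<forall>x y z. hmult H (hmult H (x \<otimes> y) \<otimes> z) = hmult H (x \<otimes> hmult H (y \<otimes> z))) \<and>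
     (\<forall>x. hmult H (hunit H \<otimes> x) = x \<and> hmult H (x \<otimes> hunit H) = x)"

definition is_coalgebra :: "'a hopf \<Rightarrow> bool" where
  "is_coalgebra H \<longleftrightarrow> qlinear (hcomult H) \<and>
     Vector_Spaces.linear qscale (*) (hcounit H) \<and>
     (\<forall>x. tassoc (tmap (hcomult H) id (hcomult H x)) = tmap id (hcomult H) (hcomult H x)) \<and>
     (\<forall>x. lin_ext (\<lambda>(a, b). qscale (hcounit H (bvec a)) (bvec b)) (hcomult H x) = x) \<and>
     (\<forall>x. lin_ext (\<lambda>(a, b). qscale (hcounit H (bvec b)) (bvec a)) (hcomult H x) = x)"

definition is_bialgebra :: "'a hopf \<Rightarrow> bool" where
  "is_bialgebra H \<longleftrightarrow> is_algebra H \<and> is_coalgebra H \<and>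
     (\<forall>x y. hcomult H (hmult H (x \<otimes> y)) =
        tmap (hmult H) (hmult H) (tmiddle (hcomult H x \<otimes> hcomult H y))) \<and>
     hcomult H (hunit H) = hunit H \<otimes> hunit H \<and>
     (\<forall>x y. hcounit H (hmult H (x \<otimes> y)) = hcounit H x * hcounit H y) \<and>
     hcounit H (hunit H) = 1"

definition is_antipode :: "'a hopf \<Rightarrow> (('a \<Rightarrow>\<^sub>0 rat) \<Rightarrow> ('a \<Rightarrow>\<^sub>0 rat)) \<Rightarrow> bool" where
  "is_antipode H S \<longleftrightarrow> qlinear S \<and>
     (\<forall>x. hmult H (tmap S id (hcomult H x)) = qscale (hcounit H x) (hunit H) \<and>
          hmult H (tmap id S (hcomult H x)) = qscale (hcounit H x) (hunit H))"

definition is_hopf_algebra :: "'a hopf \<Rightarrow> bool" where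
  "is_hopf_algebra H \<longleftrightarrow> is_bialgebra H \<and> (\<exists>S. is_antipode H S)"

text \<open>
  A Hopf algebra has exactly one antipode, so quantifying existentially or universally over
  antipodes, here and for morphisms below, makes no difference.
\<close>

definition is_hopf_subalgebra :: "'a hopf \<Rightarrow> ('a \<Rightarrow>\<^sub>0 rat) set \<Rightarrow> bool" where
  "is_hopf_subalgebra H A \<longleftrightarrow> is_hopf_algebra H \<and> qvec.subspace A \<and>
     hunit H \<in> A \<and> (\<forall>x\<in>A. \<forall>y\<in>A. hmult H (x \<otimes> y) \<in> A) \<and>
     (\<forall>x\<in>A. hcomult H x \<in> qvec.span {y \<otimes> z | y z. y \<in> A \<and> z \<in> A}) \<and>
     (\<exists>S. is_antipode H S \<and> S ` A \<subseteq> A)"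

definition cocommutative_on :: "'a hopf \<Rightarrow> ('a \<Rightarrow>\<^sub>0 rat) set \<Rightarrow> bool" where
  "cocommutative_on H A \<longleftrightarrow> (\<forall>x\<in>A. tswap (hcomult H x) = hcomult H x)"

definition is_hopf_morphism ::
    "'a hopf \<Rightarrow> 'b hopf \<Rightarrow> (('a \<Rightarrow>\<^sub>0 rat) \<Rightarrow> ('b \<Rightarrow>\<^sub>0 rat)) \<Rightarrow> bool" where
  "is_hopf_morphism H K f \<longleftrightarrow> is_hopf_algebra H \<and> is_hopf_algebra K \<and> qlinear f \<and>
     (\<forall>x y. f (hmult H (x \<otimes> y)) = hmult K (f x \<otimes> f y)) \<and>
     f (hunit H) = hunit K \<and>
     (\<forall>x. hcomult K (f x) = tmap f f (hcomult H x)) \<and>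
     (\<forall>x. hcounit K (f x) = hcounit H x) \<and>
     (\<forall>S T. is_antipode H S \<longrightarrow> is_antipode K T \<longrightarrow> (\<forall>x. f (S x) = T (f x)))"


definition rank :: "nat set \<Rightarrow> nat \<Rightarrow> nat" where
  "rank I x = card {y \<in> I. y \<le> x}"

lemma rank_strict_mono: "finite I \<Longrightarrow> strict_mono_on I (rank I)"
proof (rule strict_mono_onI)
  fix x y assume *: "finite I" "x \<in> I" "y \<in> I" "x < y"
  then have "{z \<in> I. z \<le> x} \<subseteq> {z \<in> I. z \<le> y}" "y \<in> {z \<in> I. z \<le> y} - {z \<in> I. z \<le> x}"
    by auto
  then have "{z \<in> I. z \<le> x} \<subset> {z \<in> I. z \<le> y}" by blast
  with *(1) show "rank I x < rank I y" unfolding rank_def by (intro psubset_card_mono) auto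
qed

lemma rank_bij:
  assumes "finite I"
  shows "bij_betw (rank I) I {1..card I}"
proof -
  have inj: "inj_on (rank I) I"
    using rank_strict_mono[OF assms] by (rule strict_mono_on_imp_inj_on)
  have sub: "rank I ` I \<subseteq> {1..card I}"
  proof (rule image_subsetI)
    fix x assume "x \<in> I"
    then have "{y \<in> I. y \<le> x} \<noteq> {}" "{y \<in> I. y \<le> x} \<subseteq> I" by auto
    then show "rank I x \<in> {1..card I}"
      using assms card_mono[of I "{y \<in> I. y \<le> x}"]
      by (auto simp: rank_def Suc_le_eq card_gt_0_iff)
  qed
  have "rank I ` I = {1..card I}"
    using sub inj by (intro card_subset_eq) (auto simp: card_image)
  with inj show ?thesis by (simp add: bij_betw_def)
qed


typedef packed_word = "{w :: nat list. \<exists>k. set w = {1..k}}"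
  morphisms word_of PWord
  by (rule exI[of _ "[]"], simp, rule exI[of _ 0], simp)

definition wlen :: "packed_word \<Rightarrow> nat" where
  "wlen w = length (word_of w)"

text \<open>The maximum letter is \<open>0\<close> for the empty word.\<close>

definition wmax :: "packed_word \<Rightarrow> nat" where
  "wmax w = Max (insert 0 (set (word_of w)))"

lemma set_word_of: "set (word_of w) = {1..wmax w}"
proof -
  obtain k where k: "set (word_of w) = {1..k}" using word_of[of w] by auto
  have "insert 0 {1..k} = {0..k}" by auto
  then have "wmax w = k" unfolding wmax_def k by (intro Max_eqI) auto
  with k show ?thesis by simp
qed

text \<open>Positions in a word are counted from 1.\<close>

definition wpos :: "packed_word \<Rightarrow> nat \<Rightarrow> nat set" where
  "wpos w j = {i \<in> {1..wlen w}. word_of w ! (i - 1) = j}"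

definition Pack_list :: "nat list \<Rightarrow> nat list" where
  "Pack_list u = map (rank (set u)) u"

lemma set_Pack_list: "set (Pack_list u) = {1..card (set u)}"
  using rank_bij[of "set u"] by (simp add: Pack_list_def bij_betw_def)

definition Pack :: "nat list \<Rightarrow> packed_word" where
  "Pack u = PWord (Pack_list u)"

lemma word_of_Pack: "word_of (Pack u) = Pack_list u"
  unfolding Pack_def by (rule PWord_inverse) (auto simp: set_Pack_list)

definition restr_letters :: "nat list \<Rightarrow> nat set \<Rightarrow> nat list" where
  "restr_letters u I = filter (\<lambda>x. x \<in> I) u"

lemma word_of_initial:
  assumes "i \<le> wmax w"
  shows "word_of (PWord (restr_letters (word_of w) {1..i})) = restr_letters (word_of w) {1..i}"
  by (rule PWord_inverse, rule CollectI, rule exI[of _ i])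
     (use assms in \<open>auto simp: restr_letters_def set_word_of\<close>)

definition wprod :: "packed_word \<Rightarrow> packed_word \<Rightarrow> (packed_word \<Rightarrow>\<^sub>0 rat)" where
  "wprod w w' = (\<Sum>w'' | wlen w'' = wlen w + wlen w' \<and>
       Pack (take (wlen w) (word_of w'')) = w \<and> Pack (drop (wlen w) (word_of w'')) = w'. bvec w'')"

definition wcoprod :: "packed_word \<Rightarrow> (packed_word \<times> packed_word \<Rightarrow>\<^sub>0 rat)" where
  "wcoprod w = (\<Sum>i\<in>{0..wmax w}.
       bvec (PWord (restr_letters (word_of w) {1..i})) \<otimes>
       bvec (Pack (restr_letters (word_of w) ({1..wmax w} - {1..i}))))"

text \<open>The counit is the coefficient of the empty word.\<close>

definition WQSym :: "packed_word hopf" where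
  "WQSym = \<lparr> hmult = lin_ext (\<lambda>(w, w'). wprod w w'),
             hunit = bvec (PWord []),
             hcomult = lin_ext wcoprod,
             hcounit = (\<lambda>x. Poly_Mapping.lookup x (PWord [])) \<rparr>"

lemma finite_words_of_length: "finite {w. wlen w = n}"
proof -
  have "word_of ` {w. wlen w = n} \<subseteq> {u. set u \<subseteq> {0..n} \<and> length u = n}"
  proof (clarsimp simp: wlen_def)
    fix w x assume "x \<in> set (word_of w)"
    then have "x \<le> wmax w" by (simp add: set_word_of)
    also have "wmax w = card (set (word_of w))" by (simp add: set_word_of)
    also have "\<dots> \<le> length (word_of w)" by (rule card_length)
    finally show "x \<le> length (word_of w)" .
  qed
  moreover have "finite {u. set u \<subseteq> {0..n} \<and> length u = n}"
    by (rule finite_lists_length_eq) simp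
  ultimately have "finite (word_of ` {w. wlen w = n})" by (rule finite_subset)
  then show ?thesis by (rule finite_imageD) (simp add: inj_on_def word_of_inject)
qed

text \<open>
  A set partition of \<open>{1..n}\<close> is represented by its set of blocks; \<open>n\<close> is recovered from the
  union of the blocks.
\<close>

definition set_partitions :: "nat set set set" where
  "set_partitions = {P. \<exists>n. partition_on {1..n} P}"

definition word_partition :: "packed_word \<Rightarrow> nat set set" where
  "word_partition w = wpos w ` {1..wmax w}"

definition W :: "nat set set \<Rightarrow> (packed_word \<Rightarrow>\<^sub>0 rat)" where
  "W P = (\<Sum>w | word_partition w = P. bvec w)"

lemma Union_word_partition: "\<Union>(word_partition w) = {1..wlen w}"
  using set_word_of[of w] nth_mem[of _ "word_of w"]
  by (fastforce simp: word_partition_def wpos_def wlen_def)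

lemma finite_word_partition: "finite {w. word_partition w = P}"
proof (rule finite_subset)
  show "{w. word_partition w = P} \<subseteq> {w. wlen w = card (\<Union>P)}"
    using Union_word_partition by auto
qed (rule finite_words_of_length)

definition WSym :: "(packed_word \<Rightarrow>\<^sub>0 rat) set" where
  "WSym = qvec.span (W ` set_partitions)"


typedef indexed_graph =
  "{(n :: nat, E :: nat set set). E \<subseteq> {e. e \<subseteq> {1..n} \<and> card e = 2}}"
  morphisms graph_of IGraph
  by (rule exI[of _ "(0, {})"]) simp

definition gsize :: "indexed_graph \<Rightarrow> nat" where
  "gsize G = fst (graph_of G)"

definition verts :: "indexed_graph \<Rightarrow> nat set" where
  "verts G = {1..gsize G}"

definition edges :: "indexed_graph \<Rightarrow> nat set set" where
  "edges G = snd (graph_of G)"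

lemma edgesD: "e \<in> edges G \<Longrightarrow> e \<subseteq> verts G \<and> card e = 2"
  using graph_of[of G] by (auto simp: verts_def gsize_def edges_def split: prod.splits)

definition grestr :: "indexed_graph \<Rightarrow> nat set \<Rightarrow> indexed_graph" where
  "grestr G I = IGraph (card I, (\<lambda>e. rank I ` e) ` {e \<in> edges G. e \<subseteq> I})"

lemma graph_of_grestr:
  assumes "I \<subseteq> verts G"
  shows "graph_of (grestr G I) = (card I, (\<lambda>e. rank I ` e) ` {e \<in> edges G. e \<subseteq> I})"
proof -
  have "finite I" using assms by (rule finite_subset) (simp add: verts_def)
  from rank_bij[OF this] have inj: "inj_on (rank I) I" and im: "rank I ` I = {1..card I}"
    by (auto simp: bij_betw_def)
  have "rank I ` e \<subseteq> {1..card I} \<and> card (rank I ` e) = 2" if "e \<in> edges G" "e \<subseteq> I" for e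
    using that edgesD[of e G] im inj_on_subset[OF inj] by (metis card_image image_mono)
  then show ?thesis unfolding grestr_def by (intro IGraph_inverse) blast
qed

definition gprod :: "indexed_graph \<Rightarrow> indexed_graph \<Rightarrow> indexed_graph" where
  "gprod G H = IGraph (gsize G + gsize H, edges G \<union> (\<lambda>e. (\<lambda>x. x + gsize G) ` e) ` edges H)"

lemma graph_of_gprod:
  "graph_of (gprod G H) = (gsize G + gsize H, edges G \<union> (\<lambda>e. (\<lambda>x. x + gsize G) ` e) ` edges H)"
proof -
  have "e \<subseteq> {1..gsize G + gsize H} \<and> card e = 2" if "e \<in> edges G" for e
    using edgesD[OF that] by (auto simp: verts_def)
  moreover have "(\<lambda>x. x + gsize G) ` e \<subseteq> {1..gsize G + gsize H} \<and>
      card ((\<lambda>x. x + gsize G) ` e) = 2" if "e \<in> edges H" for e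
    using edgesD[OF that] by (auto simp: verts_def card_image)
  ultimately show ?thesis unfolding gprod_def by (intro IGraph_inverse) blast
qed

definition gcoprod :: "indexed_graph \<Rightarrow> (indexed_graph \<times> indexed_graph \<Rightarrow>\<^sub>0 rat)" where
  "gcoprod G = (\<Sum>I\<in>Pow (verts G). bvec (grestr G I) \<otimes> bvec (grestr G (verts G - I)))"

text \<open>The counit is the coefficient of the graph without vertices.\<close>

definition HGraph :: "indexed_graph hopf" where
  "HGraph = \<lparr> hmult = lin_ext (\<lambda>(G, H). bvec (gprod G H)),
              hunit = bvec (IGraph (0, {})),
              hcomult = lin_ext gcoprod,
              hcounit = (\<lambda>x. Poly_Mapping.lookup x (IGraph (0, {}))) \<rparr>"

text \<open>Colorings are maps on \<^term>\<open>verts G\<close> only, hence \<^const>\<open>extensional\<close>.\<close>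

definition PVC :: "indexed_graph \<Rightarrow> (nat \<Rightarrow> nat) set" where
  "PVC G = {f \<in> extensional (verts G). (\<exists>k. f ` verts G = {1..k}) \<and>
              (\<forall>x y. {x, y} \<in> edges G \<longrightarrow> f x \<noteq> f y)}"

definition coloring_word :: "indexed_graph \<Rightarrow> (nat \<Rightarrow> nat) \<Rightarrow> packed_word" where
  "coloring_word G f = PWord (map f [1..<gsize G + 1])"

lemma word_of_coloring_word:
  assumes "f \<in> PVC G"
  shows "word_of (coloring_word G f) = map f [1..<gsize G + 1]"
proof -
  have "set [1..<gsize G + 1] = verts G" by (auto simp: verts_def)
  then show ?thesis
    unfolding coloring_word_def using assms by (intro PWord_inverse) (auto simp: PVC_def)
qed

lemma finite_PVC: "finite (PVC G)"
proof (rule finite_subset)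
  show "PVC G \<subseteq> verts G \<rightarrow>\<^sub>E {1..gsize G}"
  proof
    fix f assume f: "f \<in> PVC G"
    then obtain k where k: "f ` verts G = {1..k}" by (auto simp: PVC_def)
    have "k \<le> gsize G"
      using card_image_le[of "verts G" f] unfolding k by (simp add: verts_def)
    then have "f ` verts G \<subseteq> {1..gsize G}" unfolding k by simp
    moreover have "f \<in> extensional (verts G)" using f by (simp add: PVC_def)
    ultimately show "f \<in> verts G \<rightarrow>\<^sub>E {1..gsize G}"
      unfolding PiE_def by (intro IntI Pi_I) (blast intro: imageI)+
  qed
  show "finite (verts G \<rightarrow>\<^sub>E {1..gsize G})"
    by (rule finite_PiE) (auto simp: verts_def)
qed

definition IP :: "indexed_graph \<Rightarrow> nat set set set" where
  "IP G = {P. partition_on (verts G) P \<and> (\<forall>I\<in>P. \<forall>e\<in>edges G. \<not> e \<subseteq> I)}"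

lemma finite_IP: "finite (IP G)"
  by (rule finite_subset[of _ "Pow (Pow (verts G))"])
     (auto simp: IP_def partition_on_def verts_def)

definition F_chr :: "(indexed_graph \<Rightarrow>\<^sub>0 rat) \<Rightarrow> (packed_word \<Rightarrow>\<^sub>0 rat)" where
  "F_chr = lin_ext (\<lambda>G. \<Sum>f\<in>PVC G. bvec (coloring_word G f))"

end

theory Submission
  imports Defs
begin

text \<open>
  The coefficient of a packed word \<open>w\<close> in \<open>F_chr G\<close> is 1 if \<open>w\<close>, read as a map on the vertices, is
  a proper coloring of \<open>G\<close>, and 0 otherwise. Being proper only depends on which positions carry equal
  letters, that is on \<open>p(w)\<close>, and it says that the blocks of \<open>p(w)\<close> are independent. This is the
  formula \<open>F_chr_eq_sum_W\<close>, and it puts the image of \<open>F_chr\<close> inside \<open>WSym\<close>. Conversely, apply the formula to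
  the complete multipartite graph on the blocks of \<open>P\<close>: it gives the sum of \<open>W Q\<close> over the refinements
  \<open>Q\<close> of \<open>P\<close>, so \<open>W P\<close> is in the image by induction along refinement (\<open>W_in_range_F_chr\<close>).

  The structure of \<open>WQSym\<close> is easiest to see on coefficients. Extend the coefficients of \<open>x\<close> to all
  words \<open>u\<close> over the positive integers, giving \<open>u\<close> the coefficient of \<open>Pack u\<close>. Then
  the coefficient of a product \<open>x y\<close> at \<open>u\<close> is the sum, over all ways to cut \<open>u = p q\<close>, of the product
  of the coefficients of \<open>x\<close> at \<open>p\<close> and of \<open>y\<close> at \<open>q\<close> (\<open>lookup_hmult_WQSym\<close>). The coefficient of the coproduct of \<open>x\<close> at
  \<open>(u1, u2)\<close>, where all letters of \<open>u1\<close> are smaller than those of \<open>u2\<close>, is the sum of the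
  coefficients of \<open>x\<close> at all shuffles of \<open>u1\<close> and \<open>u2\<close> (\<open>lookup_hcomult_WQSym\<close>). As a shuffle
  determines \<open>u1\<close> and \<open>u2\<close>, its restrictions to small and to large letters, all bialgebra axioms become
  reindexings of finite sums along concatenation and filtering.

  The same formulas show that \<open>F_chr\<close> is a bialgebra morphism. A coloring of \<open>G H\<close> is a coloring of \<open>G\<close>
  followed by one of \<open>H\<close>. A shuffle of \<open>u1\<close> and \<open>u2\<close> is the same as a set \<open>I\<close> of positions for the letters
  of \<open>u1\<close>, and it colors \<open>G\<close> properly exactly if \<open>u1\<close> and \<open>u2\<close> color the restrictions of \<open>G\<close>
  to \<open>I\<close> and to its complement (\<open>proper_merge\<close>).

  Both bialgebras are graded and connected, hence have antipodes, and a bialgebra morphism commutes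
  with antipodes because both composites are convolution inverses of the morphism. The image of a Hopf algebra
  morphism is a Hopf subalgebra, and it is cocommutative because the Hopf algebra of graphs is. These
  properties of \<open>WSym\<close> are therefore read off from graphs.
\<close>

section \<open>Linear maps between spaces with a basis\<close>

lemma qlinear_iff:
  "qlinear f \<longleftrightarrow> (\<forall>x y. f (x + y) = f x + f y) \<and> (\<forall>c x. f (qscale c x) = qscale c (f x))"
  by (simp add: Vector_Spaces.linear_def module_hom_def module_hom_axioms_def
      qvec.vector_space_axioms qvec.module_axioms)

lemma qlinear_add: "qlinear f \<Longrightarrow> f (x + y) = f x + f y"
  and qlinear_scale: "qlinear f \<Longrightarrow> f (qscale c x) = qscale c (f x)"
  by (simp_all add: qlinear_iff)

lemma qlinear_0: assumes "qlinear f" shows "f 0 = 0"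
  using qlinear_scale[OF assms, of 0 0] by simp

lemma qlinear_sum: assumes "qlinear f" shows "f (sum g A) = (\<Sum>a\<in>A. f (g a))"
  by (induction A rule: infinite_finite_induct) (simp_all add: qlinear_0 qlinear_add assms)

lemma qlinear_comp: "qlinear f \<Longrightarrow> qlinear g \<Longrightarrow> qlinear (\<lambda>x. f (g x))"
  by (simp add: qlinear_iff)

lemma qlinear_id [simp]: "qlinear id" "qlinear (\<lambda>x. x)"
  by (simp_all add: qlinear_iff)

lemma lookup_bvec: "Poly_Mapping.lookup (bvec a) b = of_bool (a = b)"
  by (simp add: bvec_def lookup_single when_def)

lemma keys_bvec [simp]: "Poly_Mapping.keys (bvec a) = {a}"
  by (simp add: bvec_def)

lemma bvec_inject [simp]: "bvec a = bvec b \<longleftrightarrow> a = b"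
  by (metis keys_bvec singleton_inject)

lemma lin_ext_superset:
  assumes "finite A" "Poly_Mapping.keys x \<subseteq> A"
  shows "lin_ext f x = (\<Sum>a\<in>A. qscale (Poly_Mapping.lookup x a) (f a))"
  unfolding lin_ext_def
  by (rule sum.mono_neutral_left) (use assms in \<open>auto simp: in_keys_iff\<close>)

lemma qlinear_lin_ext [simp]: "qlinear (lin_ext f)"
proof (unfold qlinear_iff, intro conjI allI)
  fix x y :: "'a \<Rightarrow>\<^sub>0 rat" and c
  let ?A = "Poly_Mapping.keys x \<union> Poly_Mapping.keys y"
  have "lin_ext f (x + y) = (\<Sum>a\<in>?A. qscale (Poly_Mapping.lookup (x + y) a) (f a))"
    by (rule lin_ext_superset) (use Poly_Mapping.keys_add[of x y] in auto)
  also have "\<dots> = lin_ext f x + lin_ext f y"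
    by (simp add: lin_ext_superset[of ?A] lookup_add qvec.scale_left_distrib sum.distrib)
  finally show "lin_ext f (x + y) = lin_ext f x + lin_ext f y" .
  have "lin_ext f (qscale c x) = (\<Sum>a\<in>Poly_Mapping.keys x. qscale (Poly_Mapping.lookup (qscale c x) a) (f a))"
    by (rule lin_ext_superset) (auto simp: in_keys_iff)
  then show "lin_ext f (qscale c x) = qscale c (lin_ext f x)"
    by (simp add: lin_ext_def qvec.scale_sum_right)
qed

lemma lin_ext_bvec [simp]: "lin_ext f (bvec a) = f a"
  by (simp add: lin_ext_def lookup_bvec)

lemma bvec_expansion: "x = (\<Sum>a\<in>Poly_Mapping.keys x. qscale (Poly_Mapping.lookup x a) (bvec a))"
  by (rule poly_mapping_eqI) (auto simp: lookup_sum lookup_bvec in_keys_iff of_bool_def if_distrib sum.delta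
       cong: if_cong)

lemma qlinear_expansion:
  assumes "qlinear f"
  shows "f x = (\<Sum>a\<in>Poly_Mapping.keys x. qscale (Poly_Mapping.lookup x a) (f (bvec a)))"
  by (subst (1) bvec_expansion[of x]) (simp add: qlinear_sum qlinear_scale assms)

lemma qlinear_eqI:
  assumes "qlinear f" "qlinear g" "\<And>a. f (bvec a) = g (bvec a)"
  shows "f x = g x"
  using qlinear_expansion[OF assms(1), of x] qlinear_expansion[OF assms(2), of x] assms(3) by simp

lemma qlinear_pair_eqI:
  assumes "qlinear f" "qlinear g" "\<And>a b. f (bvec (a, b)) = g (bvec (a, b))"
  shows "f x = g x"
  by (rule qlinear_eqI[OF assms(1,2)]) (use assms(3) in auto)

text \<open>
  A linear map whose matrix has nonnegative integer entries is described here by its rows: the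
  coefficient at \<open>b\<close> of the image of \<open>x\<close> is a sum of coefficients of \<open>x\<close>, indexed by some finite
  set that depends on \<open>b\<close>. Such descriptions are checked on the basis, and they compose well.
\<close>

lemma lookup_pullback:
  assumes "qlinear f" "\<And>a. Poly_Mapping.lookup (f (bvec a)) b = (\<Sum>i\<in>I. of_bool (a = g i))"
  shows "Poly_Mapping.lookup (f x) b = (\<Sum>i\<in>I. Poly_Mapping.lookup x (g i))"
proof -
  have "Poly_Mapping.lookup (f x) b =
      (\<Sum>a\<in>Poly_Mapping.keys x. \<Sum>i\<in>I. Poly_Mapping.lookup x a * of_bool (a = g i))"
    by (subst qlinear_expansion[OF assms(1)]) (simp add: lookup_sum assms(2) sum_distrib_left)
  also have "\<dots> = (\<Sum>i\<in>I. \<Sum>a\<in>Poly_Mapping.keys x. Poly_Mapping.lookup x a * of_bool (a = g i))"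
    by (rule sum.swap)
  also have "\<dots> = (\<Sum>i\<in>I. Poly_Mapping.lookup x (g i))"
    by (rule sum.cong) (auto simp: of_bool_def if_distrib sum.delta' in_keys_iff cong: if_cong)
  finally show ?thesis .
qed

lemma keys_sum_bvec: "Poly_Mapping.keys (\<Sum>i\<in>I. bvec (g i)) \<subseteq> g ` I"
  using keys_sum[of "\<lambda>i. bvec (g i)" I] by auto

lemma linear_coefficient:
  "Vector_Spaces.linear qscale (*) (\<lambda>x. Poly_Mapping.lookup x e :: rat)"
  by unfold_locales (simp_all add: lookup_add algebra_simps)

section \<open>Tensor products\<close>

lemma tens_bvec [simp]: "bvec a \<otimes> bvec b = bvec (a, b)"
  by (simp add: tens_def)

lemma tens_add_left: "(x + y) \<otimes> z = x \<otimes> z + y \<otimes> z"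
  and tens_add_right: "x \<otimes> (u + v) = x \<otimes> u + x \<otimes> v"
  and tens_scale_left: "qscale c x \<otimes> z = qscale c (x \<otimes> z)"
  and tens_scale_right: "x \<otimes> qscale c u = qscale c (x \<otimes> u)"
  by (auto intro!: poly_mapping_eqI simp: lookup_tens lookup_add algebra_simps)

lemma qlinear_tens_left: "qlinear (\<lambda>x. x \<otimes> z)"
  and qlinear_tens_right: "qlinear (\<lambda>x. z \<otimes> x)"
  by (simp_all add: qlinear_iff tens_add_left tens_add_right tens_scale_left tens_scale_right)

lemmas tens_sum_left = qlinear_sum[OF qlinear_tens_left]
  and tens_sum_right = qlinear_sum[OF qlinear_tens_right]

lemma qlinear_tmap [simp]: "qlinear (tmap f g)"
  by (simp add: tmap_def)

lemma tmap_bvec [simp]: "tmap f g (bvec (a, b)) = f (bvec a) \<otimes> g (bvec b)"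
  by (simp add: tmap_def)

lemma qlinear_tswap [simp]: "qlinear tswap"
  and tswap_bvec [simp]: "tswap (bvec (a, b)) = bvec (b, a)"
  by (simp_all add: tswap_def)

lemma qlinear_tassoc [simp]: "qlinear tassoc"
  and tassoc_bvec [simp]: "tassoc (bvec ((a, b), c)) = bvec (a, (b, c))"
  by (simp_all add: tassoc_def)

lemma qlinear_tmiddle [simp]: "qlinear tmiddle"
  and tmiddle_bvec [simp]: "tmiddle (bvec ((a, b), (c, d))) = bvec ((a, c), (b, d))"
  by (simp_all add: tmiddle_def)

lemmas qlinear_compose = qlinear_comp[OF qlinear_lin_ext] qlinear_comp[OF qlinear_tens_left]
  qlinear_comp[OF qlinear_tens_right] qlinear_comp[OF qlinear_tmap] qlinear_comp[OF qlinear_tswap]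
  qlinear_comp[OF qlinear_tassoc] qlinear_comp[OF qlinear_tmiddle]

lemma bilinear_eqI:
  assumes "\<And>y. qlinear (\<lambda>x. f x y)" "\<And>y. qlinear (\<lambda>x. g x y)"
    and "\<And>x. qlinear (f x)" "\<And>x. qlinear (g x)"
    and "\<And>a b. f (bvec a) (bvec b) = g (bvec a) (bvec b)"
  shows "f x y = g x y"
proof (rule qlinear_eqI[OF assms(1,2)])
  show "f (bvec a) y = g (bvec a) y" for a
    by (rule qlinear_eqI[OF assms(3,4,5)])
qed

lemma tmap_tens:
  assumes "qlinear f" "qlinear g"
  shows "tmap f g (x \<otimes> y) = f x \<otimes> g y"
  by (rule bilinear_eqI)
     (simp_all add: qlinear_compose qlinear_tens_left qlinear_tens_right assms)

lemma tmap_comp: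
  assumes "qlinear f" "qlinear g" "qlinear f'" "qlinear g'"
  shows "tmap f g (tmap f' g' t) = tmap (\<lambda>x. f (f' x)) (\<lambda>x. g (g' x)) t"
  by (rule qlinear_pair_eqI) (simp_all add: qlinear_compose tmap_tens assms)

lemma tassoc_tens: "tassoc ((x \<otimes> y) \<otimes> z) = x \<otimes> (y \<otimes> z)"
proof (rule qlinear_eqI[where f = "\<lambda>x. tassoc ((x \<otimes> y) \<otimes> z)"])
  show "tassoc ((bvec a \<otimes> y) \<otimes> z) = bvec a \<otimes> y \<otimes> z" for a
    by (rule bilinear_eqI[where f = "\<lambda>y z. tassoc ((bvec a \<otimes> y) \<otimes> z)"])
       (simp_all add: qlinear_compose qlinear_tens_left qlinear_tens_right)
qed (simp_all add: qlinear_compose qlinear_tens_left)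

lemma tassoc_tmap:
  assumes "qlinear f" "qlinear g" "qlinear h"
  shows "tassoc (tmap (tmap f g) h t) = tmap f (tmap g h) (tassoc t)"
proof (rule qlinear_eqI[where f = "\<lambda>t. tassoc (tmap (tmap f g) h t)"])
  show "tassoc (tmap (tmap f g) h (bvec a)) = tmap f (tmap g h) (tassoc (bvec a))" for a
    by (cases a; cases "fst a") (auto simp: tassoc_tens)
qed (simp_all add: qlinear_compose)

lemma lookup_tassoc:
  "Poly_Mapping.lookup (tassoc t) (a, (b, c)) = Poly_Mapping.lookup t ((a, b), c)"
  using lookup_pullback[of tassoc "(a, (b, c))" "\<lambda>_. ((a, b), c)" "{()}" t]
  by (force simp: lookup_bvec)

lemma lookup_tmiddle:
  "Poly_Mapping.lookup (tmiddle t) ((a, c), (b, d)) = Poly_Mapping.lookup t ((a, b), (c, d))"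
  using lookup_pullback[of tmiddle "((a, c), (b, d))" "\<lambda>_. ((a, b), (c, d))" "{()}" t]
  by (force simp: lookup_bvec)

lemma lookup_tmap:
  assumes f: "\<And>x. Poly_Mapping.lookup (f x) c = (\<Sum>i\<in>I. Poly_Mapping.lookup x (p i))"
    and g: "\<And>x. Poly_Mapping.lookup (g x) d = (\<Sum>j\<in>J. Poly_Mapping.lookup x (q j))"
  shows "Poly_Mapping.lookup (tmap f g t) (c, d) =
    (\<Sum>i\<in>I. \<Sum>j\<in>J. Poly_Mapping.lookup t (p i, q j))"
proof -
  have "Poly_Mapping.lookup (tmap f g t) (c, d) =
      (\<Sum>i\<in>I \<times> J. Poly_Mapping.lookup t (p (fst i), q (snd i)))"
  proof (rule lookup_pullback)
    fix ab :: "'a \<times> 'd"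
    have "of_bool (ab = (p i, q j)) = (of_bool (fst ab = p i) * of_bool (snd ab = q j) :: rat)" for i j
      by (cases ab) auto
    then show "Poly_Mapping.lookup (tmap f g (bvec ab)) (c, d) =
        (\<Sum>i\<in>I \<times> J. of_bool (ab = (p (fst i), q (snd i))))"
      by (cases ab) (simp add: lookup_tens f g lookup_bvec sum_product sum.cartesian_product split_def)
  qed simp
  then show ?thesis by (simp add: sum.cartesian_product split_def)
qed

text \<open>
  When the counit is the coefficient at a basis element \<open>e\<close>, the counit axioms say that certain
  coefficients of \<open>\<Delta>(x)\<close> are those of \<open>x\<close>.
\<close>

lemma lookup_counit_left:
  "Poly_Mapping.lookup (lin_ext (\<lambda>(a, b). qscale (Poly_Mapping.lookup (bvec a) e) (bvec b)) t) b =
    Poly_Mapping.lookup t (e, b)" (is "Poly_Mapping.lookup (?l t) b = _")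
proof -
  have "Poly_Mapping.lookup (?l t) b = (\<Sum>i\<in>{()}. Poly_Mapping.lookup t (e, b))"
    by (rule lookup_pullback) (auto simp: lookup_bvec split: prod.split)
  then show ?thesis by simp
qed

lemma lookup_counit_right:
  "Poly_Mapping.lookup (lin_ext (\<lambda>(a, b). qscale (Poly_Mapping.lookup (bvec b) e) (bvec a)) t) a =
    Poly_Mapping.lookup t (a, e)" (is "Poly_Mapping.lookup (?l t) a = _")
proof -
  have "Poly_Mapping.lookup (?l t) a = (\<Sum>i\<in>{()}. Poly_Mapping.lookup t (a, e))"
    by (rule lookup_pullback) (auto simp: lookup_bvec split: prod.split)
  then show ?thesis by simp
qed

section \<open>Convolution and antipodes\<close>

text \<open>
  An antipode of \<open>H\<close> is a two-sided inverse of the identity for the convolution product on linear maps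
  \<open>H \<rightarrow> H\<close>. Convolution of maps between two different Hopf algebras is what relates their antipodes.
\<close>

definition conv :: "'a hopf \<Rightarrow> 'b hopf \<Rightarrow> (('a \<Rightarrow>\<^sub>0 rat) \<Rightarrow> ('b \<Rightarrow>\<^sub>0 rat)) \<Rightarrow>
    (('a \<Rightarrow>\<^sub>0 rat) \<Rightarrow> ('b \<Rightarrow>\<^sub>0 rat)) \<Rightarrow> ('a \<Rightarrow>\<^sub>0 rat) \<Rightarrow> ('b \<Rightarrow>\<^sub>0 rat)" where
  "conv H K f g x = hmult K (tmap f g (hcomult H x))"

definition conv_unit :: "'a hopf \<Rightarrow> 'b hopf \<Rightarrow> ('a \<Rightarrow>\<^sub>0 rat) \<Rightarrow> ('b \<Rightarrow>\<^sub>0 rat)" where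
  "conv_unit H K x = qscale (hcounit H x) (hunit K)"

lemma is_antipode_iff_conv_inverse:
  "is_antipode H S \<longleftrightarrow> qlinear S \<and> conv H H S id = conv_unit H H \<and> conv H H id S = conv_unit H H"
  by (auto simp: is_antipode_def conv_def conv_unit_def fun_eq_iff)

lemma qlinear_conv:
  assumes "is_coalgebra H" "is_algebra K"
  shows "qlinear (conv H K f g)"
proof -
  have "qlinear (hmult K)" "qlinear (hcomult H)"
    using assms by (simp_all add: is_coalgebra_def is_algebra_def)
  then show ?thesis by (simp add: conv_def[abs_def] qlinear_comp[of "hmult K"] qlinear_compose)
qed

lemma counit_additive:
  assumes "is_coalgebra H"
  shows "hcounit H (x + y) = hcounit H x + hcounit H y"
    and "hcounit H (qscale c x) = c * hcounit H x"
  using assms by (auto simp: is_coalgebra_def Vector_Spaces.linear_def module_hom_def module_hom_axioms_def)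

lemma qlinear_conv_unit: "is_coalgebra H \<Longrightarrow> qlinear (conv_unit H K)"
  by (simp add: qlinear_iff conv_unit_def counit_additive qvec.scale_left_distrib)

lemma algebra_assoc_triple:
  assumes "is_algebra K"
  shows "hmult K (tmap (hmult K) id t) = hmult K (tmap id (hmult K) (tassoc t))"
proof (rule qlinear_eqI[where f = "\<lambda>t. hmult K (tmap (hmult K) id t)"])
  have K: "qlinear (hmult K)"
    using assms by (simp add: is_algebra_def)
  show "qlinear (\<lambda>t. hmult K (tmap (hmult K) id t))" "qlinear (\<lambda>t. hmult K (tmap id (hmult K) (tassoc t)))"
    by (simp_all add: qlinear_comp[OF K] qlinear_compose)
  fix a :: "('a \<times> 'a) \<times> 'a"
  obtain b c d where a: "a = ((b, c), d)" by (metis surj_pair)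
  have "hmult K (hmult K (bvec b \<otimes> bvec c) \<otimes> bvec d) = hmult K (bvec b \<otimes> hmult K (bvec c \<otimes> bvec d))"
    using assms unfolding is_algebra_def by blast
  then show "hmult K (tmap (hmult K) id (bvec a)) = hmult K (tmap id (hmult K) (tassoc (bvec a)))"
    by (simp add: a)
qed

lemma conv_assoc:
  assumes "is_coalgebra H" "is_algebra K" "qlinear f" "qlinear g" "qlinear h"
  shows "conv H K (conv H K f g) h = conv H K f (conv H K g h)"
proof
  fix x
  have K: "qlinear (hmult K)" and H: "qlinear (hcomult H)"
    using assms by (simp_all add: is_coalgebra_def is_algebra_def)
  have coassoc: "tassoc (tmap (hcomult H) id (hcomult H x)) = tmap id (hcomult H) (hcomult H x)"
    using assms(1) by (simp add: is_coalgebra_def)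
  have "conv H K (conv H K f g) h x =
      hmult K (tmap (hmult K) id (tmap (tmap f g) h (tmap (hcomult H) id (hcomult H x))))"
    by (simp add: conv_def[abs_def] tmap_comp K H qlinear_comp[OF K] qlinear_compose assms)
  also have "\<dots> = hmult K (tmap id (hmult K) (tmap f (tmap g h) (tmap id (hcomult H) (hcomult H x))))"
    by (simp add: algebra_assoc_triple assms tassoc_tmap coassoc)
  also have "\<dots> = conv H K f (conv H K g h) x"
    by (simp add: conv_def[abs_def] tmap_comp K H qlinear_comp[OF K] qlinear_compose assms)
  finally show "conv H K (conv H K f g) h x = conv H K f (conv H K g h) x" .
qed

lemma conv_unit_left:
  assumes "is_coalgebra H" "is_algebra K" "qlinear f"
  shows "conv H K (conv_unit H K) f = f"
proof
  fix x
  let ?c = "lin_ext (\<lambda>(a, b). qscale (hcounit H (bvec a)) (bvec b))"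
  have K: "qlinear (hmult K)" "\<And>y. hmult K (hunit K \<otimes> y) = y"
    using assms by (simp_all add: is_algebra_def)
  have "hmult K (tmap (conv_unit H K) f t) = f (?c t)" for t
    by (rule qlinear_pair_eqI[where f = "\<lambda>t. hmult K (tmap (conv_unit H K) f t)"])
       (simp_all add: qlinear_comp[OF K(1)] qlinear_comp[OF assms(3)] assms K conv_unit_def tens_scale_left qlinear_scale)
  then show "conv H K (conv_unit H K) f x = f x"
    using assms by (simp add: conv_def is_coalgebra_def)
qed

lemma conv_unit_right:
  assumes "is_coalgebra H" "is_algebra K" "qlinear f"
  shows "conv H K f (conv_unit H K) = f"
proof
  fix x
  let ?c = "lin_ext (\<lambda>(a, b). qscale (hcounit H (bvec b)) (bvec a))"
  have K: "qlinear (hmult K)" "\<And>y. hmult K (y \<otimes> hunit K) = y"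
    using assms by (simp_all add: is_algebra_def)
  have "hmult K (tmap f (conv_unit H K) t) = f (?c t)" for t
    by (rule qlinear_pair_eqI[where f = "\<lambda>t. hmult K (tmap f (conv_unit H K) t)"])
       (simp_all add: qlinear_comp[OF K(1)] qlinear_comp[OF assms(3)] assms K conv_unit_def tens_scale_right qlinear_scale)
  then show "conv H K f (conv_unit H K) x = f x"
    using assms by (simp add: conv_def is_coalgebra_def)
qed

text \<open>\<open>g = g * (f * h) = (g * f) * h = h\<close>.\<close>

lemma conv_inverse_unique:
  assumes "is_coalgebra H" "is_algebra K" "qlinear f" "qlinear g" "qlinear h"
    and "conv H K g f = conv_unit H K" "conv H K f h = conv_unit H K"
  shows "g = h"
proof -
  have "g = conv H K g (conv H K f h)"
    by (simp add: conv_unit_right assms)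
  also have "\<dots> = conv H K (conv H K g f) h"
    by (simp add: conv_assoc assms(1-5))
  also have "\<dots> = h"
    by (simp add: conv_unit_left assms)
  finally show ?thesis .
qed

text \<open>
  In a graded connected coalgebra, \<open>\<Delta>(a) = a \<otimes> 1\<close> up to terms whose left factor has smaller
  degree, so the equation \<open>S * g = \<eta>\<epsilon>\<close> determines \<open>S(a)\<close> from values of \<open>S\<close> in smaller degree.
  The terms with the unit as right factor are those that the counit axiom determines.
\<close>

lemma graded_left_conv_inverse:
  fixes H :: "'a hopf" and deg :: "'a \<Rightarrow> nat"
  assumes H: "is_bialgebra H" "hunit H = bvec e" "\<And>x. hcounit H x = Poly_Mapping.lookup x e"
    and deg: "\<And>a b c. (b, c) \<in> Poly_Mapping.keys (hcomult H (bvec a)) \<Longrightarrow> deg b + deg c = deg a"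
    and connected: "\<And>a. deg a = 0 \<Longrightarrow> a = e"
    and g: "qlinear g" "g (bvec e) = bvec e"
  obtains S where "qlinear S" "S (bvec e) = bvec e" "conv H H S g = conv_unit H H"
proof -
  have coalg: "is_coalgebra H" and alg: "is_algebra H"
    using H by (simp_all add: is_bialgebra_def)
  have m: "qlinear (hmult H)" "\<And>x. hmult H (x \<otimes> bvec e) = x"
    using alg H(2) by (simp_all add: is_algebra_def)
  have comult_e: "hcomult H (bvec e) = bvec (e, e)"
    using H(1,2) by (simp add: is_bialgebra_def)
  have coeff: "Poly_Mapping.lookup (hcomult H (bvec a)) (b, e) = of_bool (a = b)" for a b
  proof -
    have "lin_ext (\<lambda>(a, b). qscale (Poly_Mapping.lookup (bvec b) e) (bvec a)) (hcomult H (bvec a)) = bvec a"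
      using coalg by (simp add: is_coalgebra_def H(3))
    then show ?thesis
      using lookup_counit_right[of e "hcomult H (bvec a)" b] by (simp only: lookup_bvec)
  qed
  let ?K = "\<lambda>a. Poly_Mapping.keys (hcomult H (bvec a))"
  let ?c = "\<lambda>a. Poly_Mapping.lookup (hcomult H (bvec a))"
  define s where "s = wfrec (measure deg) (\<lambda>s a. if a = e then bvec e else
      - (\<Sum>p\<in>?K a - {(a, e)}. qscale (?c a p) (hmult H (s (fst p) \<otimes> g (bvec (snd p))))))"
  have s_e: "s e = bvec e"
    unfolding s_def by (subst wfrec) simp_all
  have s: "s a = - (\<Sum>p\<in>?K a - {(a, e)}. qscale (?c a p) (hmult H (s (fst p) \<otimes> g (bvec (snd p)))))"
    if "a \<noteq> e" for a
  proof -
    have "deg (fst p) < deg a" if "p \<in> ?K a - {(a, e)}" for p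
    proof -
      obtain b c where p: "p = (b, c)" by fastforce
      with that have "deg b + deg c = deg a" "?c a (b, c) \<noteq> 0"
        using deg by (auto simp: in_keys_iff)
      moreover have "c \<noteq> e"
        using that coeff[of a b] by (auto simp: p in_keys_iff)
      ultimately show ?thesis using connected[of c] by (cases "deg c") (auto simp: p)
    qed
    then show ?thesis
      using that unfolding s_def by (subst wfrec) (simp_all add: cut_apply)
  qed
  define S where "S = lin_ext s"
  have "conv H H S g (bvec a) = conv_unit H H (bvec a)" for a
  proof (cases "a = e")
    case True
    then show ?thesis
      using m(2)[of "bvec e"] by (simp add: conv_def comult_e S_def s_e g conv_unit_def H(2,3) lookup_bvec)
  next
    case False
    have lin: "qlinear (\<lambda>t. hmult H (tmap S g t))"
      by (simp add: qlinear_comp[OF m(1)])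
    have terms: "hmult H (tmap S g (bvec p)) = hmult H (s (fst p) \<otimes> g (bvec (snd p)))" for p
      by (cases p) (simp add: S_def)
    have mem: "(a, e) \<in> ?K a" using coeff[of a a] by (simp add: in_keys_iff)
    have "conv H H S g (bvec a) = (\<Sum>p\<in>?K a. qscale (?c a p) (hmult H (s (fst p) \<otimes> g (bvec (snd p)))))"
      unfolding conv_def by (subst qlinear_expansion[OF lin]) (simp add: terms)
    also have "\<dots> = s a + (\<Sum>p\<in>?K a - {(a, e)}. qscale (?c a p) (hmult H (s (fst p) \<otimes> g (bvec (snd p)))))"
      by (subst sum.remove[OF _ mem]) (simp_all add: coeff g m)
    also have "\<dots> = 0" using s[OF False] by simp
    finally show ?thesis using False by (simp add: conv_unit_def H(3) lookup_bvec)
  qed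
  then have "conv H H S g = conv_unit H H"
    by (intro ext, rule qlinear_eqI[OF qlinear_conv[OF coalg alg] qlinear_conv_unit[OF coalg]])
  then show thesis by (rule that[rotated 2]) (simp_all only: S_def qlinear_lin_ext lin_ext_bvec s_e)
qed

text \<open>
  A left inverse \<open>S\<close> of the identity sends the unit to itself, so it has a left inverse \<open>T\<close>
  in turn. Then \<open>T = T * (S * id) = id\<close>, and \<open>S\<close> is also a right inverse.
\<close>

lemma graded_connected_hopf:
  fixes H :: "'a hopf" and deg :: "'a \<Rightarrow> nat"
  assumes H: "is_bialgebra H" "hunit H = bvec e" "\<And>x. hcounit H x = Poly_Mapping.lookup x e"
    and deg: "\<And>a b c. (b, c) \<in> Poly_Mapping.keys (hcomult H (bvec a)) \<Longrightarrow> deg b + deg c = deg a"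
    and connected: "\<And>a. deg a = 0 \<Longrightarrow> a = e"
  shows "is_hopf_algebra H"
proof -
  have coalg: "is_coalgebra H" and alg: "is_algebra H"
    using H by (simp_all add: is_bialgebra_def)
  obtain S where S: "qlinear S" "S (bvec e) = bvec e" "conv H H S id = conv_unit H H"
    by (rule graded_left_conv_inverse[where deg = deg, OF assms qlinear_id(1) id_apply])
  obtain T where T: "qlinear T" "conv H H T S = conv_unit H H"
    by (rule graded_left_conv_inverse[where deg = deg, OF assms S(1,2)])
  have "T = id"
    by (rule conv_inverse_unique[OF coalg alg S(1) T(1) qlinear_id(1) T(2) S(3)])
  with S T have "is_antipode H S" by (simp add: is_antipode_iff_conv_inverse)
  with H(1) show ?thesis unfolding is_hopf_algebra_def by blast
qed

text \<open>Both \<open>f \<circ> S\<close> and \<open>T \<circ> f\<close> are convolution inverses of \<open>f\<close>.\<close>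

lemma bialgebra_morphism_antipode:
  assumes "is_bialgebra H" "is_bialgebra K" "qlinear f"
    and mult: "\<And>x y. f (hmult H (x \<otimes> y)) = hmult K (f x \<otimes> f y)"
    and unit: "f (hunit H) = hunit K"
    and comult: "\<And>x. hcomult K (f x) = tmap f f (hcomult H x)"
    and counit: "\<And>x. hcounit K (f x) = hcounit H x"
    and S: "is_antipode H S" and T: "is_antipode K T"
  shows "f (S x) = T (f x)"
proof -
  have H: "is_coalgebra H" and K: "is_algebra K"
    and lin: "qlinear (hmult H)" "qlinear (hmult K)"
    using assms by (simp_all add: is_bialgebra_def is_algebra_def)
  have mult': "f (hmult H t) = hmult K (tmap f f t)" for t
    by (rule qlinear_pair_eqI[of "\<lambda>t. f (hmult H t)"])
       (simp_all add: qlinear_comp[OF assms(3)] qlinear_comp[OF lin(2)] assms(3) lin flip: mult)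
  have S': "qlinear S" "\<And>x. hmult H (tmap S id (hcomult H x)) = qscale (hcounit H x) (hunit H)"
    and T': "qlinear T" "\<And>x. hmult K (tmap id T (hcomult K x)) = qscale (hcounit K x) (hunit K)"
    using S T by (simp_all add: is_antipode_def)
  have "conv H K (\<lambda>x. f (S x)) f x = conv_unit H K x" for x
  proof -
    have "conv H K (\<lambda>x. f (S x)) f x = hmult K (tmap f f (tmap S id (hcomult H x)))"
      by (simp add: tmap_comp assms(3) S' conv_def)
    also have "\<dots> = conv_unit H K x"
      by (simp add: S' assms(3) qlinear_scale unit conv_unit_def flip: mult')
    finally show ?thesis .
  qed
  moreover have "conv H K f (\<lambda>x. T (f x)) x = conv_unit H K x" for x
  proof -
    have "conv H K f (\<lambda>x. T (f x)) x = hmult K (tmap id T (tmap f f (hcomult H x)))"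
      by (simp add: tmap_comp assms(3) T' conv_def)
    also have "\<dots> = conv_unit H K x"
      by (simp add: T' counit conv_unit_def flip: comult)
    finally show ?thesis .
  qed
  ultimately have "conv H K (\<lambda>x. f (S x)) f = conv_unit H K"
    "conv H K f (\<lambda>x. T (f x)) = conv_unit H K"
    by (auto simp: fun_eq_iff)
  then have "(\<lambda>x. f (S x)) = (\<lambda>x. T (f x))"
    by (rule conv_inverse_unique[OF H K assms(3) qlinear_comp[OF assms(3) S'(1)] qlinear_comp[OF T'(1) assms(3)]])
  then show ?thesis by (rule fun_cong)
qed

section \<open>Ranks\<close>

text \<open>
  Relabelling of graphs and packing of words are both given by \<^const>\<open>rank\<close>. Since an increasing map
  preserves ranks, relabelling or packing in two steps agrees with doing it at once.
\<close>

lemma rank_image: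
  assumes "strict_mono_on S f" "x \<in> S"
  shows "rank (f ` S) (f x) = rank S x"
proof -
  have le: "f y \<le> f x \<longleftrightarrow> y \<le> x" if "y \<in> S" for y
    using that assms by (simp add: strict_mono_on_less_eq)
  have "{y \<in> f ` S. y \<le> f x} = f ` {y \<in> S. y \<le> x}"
    using le by auto
  moreover have "inj_on f {y \<in> S. y \<le> x}"
    by (rule inj_on_subset[OF strict_mono_on_imp_inj_on[OF assms(1)]]) auto
  ultimately show ?thesis by (simp add: rank_def card_image)
qed

lemma rank_interval: "x \<in> {1..k} \<Longrightarrow> rank {1..k} x = x"
proof -
  assume "x \<in> {1..k}"
  then have "{y \<in> {1..k}. y \<le> x} = {1..x}" by auto
  then show ?thesis by (simp add: rank_def)
qed

lemma rank_append_left: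
  assumes "\<And>y. y \<in> J \<Longrightarrow> x < y"
  shows "rank (I \<union> J) x = rank I x"
  unfolding rank_def by (rule arg_cong[of _ _ card]) (use assms in force)

lemma rank_append_right:
  assumes "finite I" "finite J" "\<And>y. y \<in> I \<Longrightarrow> y \<le> x" "I \<inter> J = {}"
  shows "rank (I \<union> J) x = card I + rank J x"
proof -
  have "{y \<in> I \<union> J. y \<le> x} = I \<union> {y \<in> J. y \<le> x}" using assms(3) by auto
  then show ?thesis unfolding rank_def using assms(1,2,4) by (simp add: card_Un_disjoint disjoint_iff)
qed

section \<open>The Hopf algebra of indexed graphs\<close>

lemma finite_verts [simp]: "finite (verts G)"
  by (simp add: verts_def)

lemma card_verts [simp]: "card (verts G) = gsize G"
  by (simp add: verts_def)

lemma graph_eqI: "gsize G = gsize H \<Longrightarrow> edges G = edges H \<Longrightarrow> G = H"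
  by (metis edges_def gsize_def graph_of_inject prod_eq_iff)

lemma graph_of_eq: "graph_of G = (n, E) \<Longrightarrow> gsize G = n"  "graph_of G = (n, E) \<Longrightarrow> edges G = E"
  by (simp_all add: gsize_def edges_def)

lemmas gsize_grestr = graph_of_eq(1)[OF graph_of_grestr]
  and edges_grestr = graph_of_eq(2)[OF graph_of_grestr]
  and gsize_gprod = graph_of_eq(1)[OF graph_of_gprod]
  and edges_gprod = graph_of_eq(2)[OF graph_of_gprod]

definition empty_graph :: indexed_graph where
  "empty_graph = IGraph (0, {})"

lemma graph_of_empty: "graph_of empty_graph = (0, {})"
  unfolding empty_graph_def by (rule IGraph_inverse) simp

lemmas gsize_empty [simp] = graph_of_eq(1)[OF graph_of_empty]
  and edges_empty [simp] = graph_of_eq(2)[OF graph_of_empty]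

lemma gsize_0_iff: "gsize G = 0 \<longleftrightarrow> G = empty_graph"
proof
  assume G: "gsize G = 0"
  then have "edges G = {}" using edgesD[of _ G] by (fastforce simp: verts_def)
  with G show "G = empty_graph" by (intro graph_eqI) simp_all
qed simp

lemma rank_bij_verts: 
  assumes "I \<subseteq> verts G"
  shows "bij_betw (rank I) I (verts (grestr G I))"
proof -
  have "finite I" using assms by (rule finite_subset) simp
  then show ?thesis using rank_bij[of I] assms by (simp add: verts_def gsize_grestr)
qed

lemma grestr_grestr:
  assumes "J \<subseteq> I" "I \<subseteq> verts G"
  shows "grestr (grestr G I) (rank I ` J) = grestr G J"
proof (rule graph_eqI)
  have fin: "finite I" using assms(2) by (rule finite_subset) simp
  have inj: "inj_on (rank I) I" and im: "rank I ` I = verts (grestr G I)"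
    using rank_bij_verts[OF assms(2)] by (simp_all add: bij_betw_def)
  have sub: "rank I ` J \<subseteq> verts (grestr G I)" "J \<subseteq> verts G"
    using assms im by auto
  show "gsize (grestr (grestr G I) (rank I ` J)) = gsize (grestr G J)"
    using sub inj assms(1) by (simp add: gsize_grestr card_image inj_on_subset)
  have "rank (rank I ` J) ` (rank I ` e) = rank J ` e" if "e \<subseteq> J" for e
  proof -
    have "strict_mono_on J (rank I)"
      using rank_strict_mono[OF fin] assms(1) by (rule monotone_on_subset)
    then have "rank (rank I ` J) (rank I x) = rank J x" if "x \<in> e" for x
      using that \<open>e \<subseteq> J\<close> by (intro rank_image) auto
    then show ?thesis by (force simp: image_image)
  qed
  moreover have "rank I ` e \<subseteq> rank I ` J \<longleftrightarrow> e \<subseteq> J" if "e \<subseteq> I" for e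
    using that assms(1) inj_on_image_mem_iff[OF inj, of _ J] unfolding image_subset_iff by blast
  then have "{e \<in> (\<lambda>e. rank I ` e) ` {e \<in> edges G. e \<subseteq> I}. e \<subseteq> rank I ` J} =
      (\<lambda>e. rank I ` e) ` {e \<in> edges G. e \<subseteq> J}"
    using assms(1) by auto
  ultimately show "edges (grestr (grestr G I) (rank I ` J)) = edges (grestr G J)"
    using sub assms(2) by (simp add: edges_grestr image_image cong: image_cong_simp)
qed

lemma grestr_verts: "grestr G (verts G) = G"
proof (rule graph_eqI)
  have "rank (verts G) ` e = e" if "e \<in> edges G" for e
    using edgesD[OF that] rank_interval[of _ "gsize G"] by (force simp: verts_def)
  then show "edges (grestr G (verts G)) = edges G"
    using edgesD[of _ G] by (auto simp: edges_grestr image_iff)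
qed (simp add: gsize_grestr)

lemma gsize_grestr_0: "I \<subseteq> verts G \<Longrightarrow> grestr G I = empty_graph \<longleftrightarrow> I = {}"
  using finite_subset[of I "verts G"] by (auto simp: gsize_grestr simp flip: gsize_0_iff)

lemma gprod_assoc: "gprod (gprod G H) K = gprod G (gprod H K)"
  by (rule graph_eqI)
     (auto simp: gsize_gprod edges_gprod image_Un image_image add.assoc add.commute[of "gsize H"])

lemma gprod_empty: "gprod empty_graph G = G" "gprod G empty_graph = G"
  by (auto intro!: graph_eqI simp: gsize_gprod edges_gprod)

lemma verts_gprod: "verts (gprod G H) = verts G \<union> (\<lambda>x. x + gsize G) ` verts H"
  by (auto simp: verts_def gsize_gprod image_iff)

lemma grestr_gprod:
  assumes "I \<subseteq> verts G" "J \<subseteq> verts H"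
  shows "grestr (gprod G H) (I \<union> (\<lambda>x. x + gsize G) ` J) = gprod (grestr G I) (grestr H J)"
proof (rule graph_eqI)
  let ?sh = "\<lambda>x. x + gsize G"
  let ?K = "I \<union> ?sh ` J"
  have fin: "finite I" "finite J" using assms by (auto intro: finite_subset)
  have K: "?K \<subseteq> verts (gprod G H)" using assms by (auto simp: verts_gprod)
  have I_le: "x \<le> gsize G" if "x \<in> I" for x using that assms by (auto simp: verts_def)
  have J_gt: "gsize G < y" if "y \<in> ?sh ` J" for y using that assms by (auto simp: verts_def)
  have disj: "I \<inter> ?sh ` J = {}" using I_le J_gt by fastforce
  have card_J: "card (?sh ` J) = card J" by (simp add: card_image)
  show "gsize (grestr (gprod G H) ?K) = gsize (gprod (grestr G I) (grestr H J))"
    using K assms fin disj by (simp add: gsize_grestr gsize_gprod card_Un_disjoint card_J)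
  have "rank ?K x = rank I x" if "x \<in> I" for x
    using I_le[OF that] J_gt by (intro rank_append_left) force
  then have left: "rank ?K ` e = rank I ` e" if "e \<subseteq> I" for e
    using that by (force intro!: image_cong)
  have "rank ?K (?sh y) = rank J y + card I" if "y \<in> J" for y
  proof -
    have "rank ?K (?sh y) = card I + rank (?sh ` J) (?sh y)"
      using fin I_le disj by (intro rank_append_right) (auto intro: trans_le_add2)
    also have "rank (?sh ` J) (?sh y) = rank J y"
      using that by (intro rank_image) (auto simp: strict_mono_on_def)
    finally show ?thesis by simp
  qed
  then have right: "rank ?K ` ?sh ` e = (\<lambda>x. x + card I) ` rank J ` e" if "e \<subseteq> J" for e
    using that by (force intro!: image_cong simp: image_image)
  have "e \<subseteq> ?K \<longleftrightarrow> e \<subseteq> I" if "e \<in> edges G" for e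
    using edgesD[OF that] J_gt by (fastforce simp: verts_def)
  moreover have "?sh ` e \<subseteq> ?K \<longleftrightarrow> e \<subseteq> J" if "e \<in> edges H" for e
    using edgesD[OF that] I_le by (fastforce simp: verts_def)
  ultimately have "{e \<in> edges (gprod G H). e \<subseteq> ?K} =
      {e \<in> edges G. e \<subseteq> I} \<union> (\<lambda>e. ?sh ` e) ` {e \<in> edges H. e \<subseteq> J}"
    by (auto simp: edges_gprod)
  moreover have "(\<lambda>e. rank ?K ` e) ` {e \<in> edges G. e \<subseteq> I} = (\<lambda>e. rank I ` e) ` {e \<in> edges G. e \<subseteq> I}"
    by (rule image_cong) (auto simp: left)
  moreover have "(\<lambda>e. rank ?K ` e) ` (\<lambda>e. ?sh ` e) ` {e \<in> edges H. e \<subseteq> J} =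
      (\<lambda>e. (\<lambda>x. x + card I) ` rank J ` e) ` {e \<in> edges H. e \<subseteq> J}"
    unfolding image_image[of "\<lambda>e. rank ?K ` e" "\<lambda>e. ?sh ` e"] by (rule image_cong) (auto simp: right)
  ultimately show "edges (grestr (gprod G H) ?K) = edges (gprod (grestr G I) (grestr H J))"
    using K assms by (simp add: edges_grestr edges_gprod gsize_grestr image_Un image_image)
qed

text \<open>
  Subsets of the relabelled vertex set correspond to subsets of \<open>I\<close>, so that iterated coproducts can be
  written with restrictions of the single graph \<open>G\<close>.
\<close>

lemma gcoprod_grestr:
  assumes "I \<subseteq> verts G"
  shows "gcoprod (grestr G I) = (\<Sum>J\<in>Pow I. bvec (grestr G J, grestr G (I - J)))"
proof -
  note bij = rank_bij_verts[OF assms]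
  have "gcoprod (grestr G I) = (\<Sum>J\<in>Pow I. bvec (grestr (grestr G I) (rank I ` J),
      grestr (grestr G I) (verts (grestr G I) - rank I ` J)))"
    unfolding gcoprod_def tens_bvec by (rule sum.reindex_bij_betw[OF bij_betw_Pow[OF bij], symmetric])
  also have "\<dots> = (\<Sum>J\<in>Pow I. bvec (grestr G J, grestr G (I - J)))"
  proof (rule sum.cong[OF refl])
    fix J assume "J \<in> Pow I"
    then have "verts (grestr G I) - rank I ` J = rank I ` (I - J)"
      using bij inj_on_image_set_diff[of "rank I" I I J] by (auto simp: bij_betw_def)
    with \<open>J \<in> Pow I\<close> show "bvec (grestr (grestr G I) (rank I ` J),
        grestr (grestr G I) (verts (grestr G I) - rank I ` J)) = bvec (grestr G J, grestr G (I - J))"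
      using assms by (simp add: grestr_grestr)
  qed
  finally show ?thesis .
qed

lemma gcoprod_eq: "gcoprod G = (\<Sum>I\<in>Pow (verts G). bvec (grestr G I, grestr G (verts G - I)))"
  by (simp add: gcoprod_def)

lemma hmult_HGraph [simp]: "qlinear (hmult HGraph)" "hmult HGraph (bvec (G, H)) = bvec (gprod G H)"
  and hcomult_HGraph [simp]: "qlinear (hcomult HGraph)" "hcomult HGraph (bvec G) = gcoprod G"
  and hunit_HGraph: "hunit HGraph = bvec empty_graph"
  and hcounit_HGraph: "hcounit HGraph x = Poly_Mapping.lookup x empty_graph"
  by (simp_all add: HGraph_def empty_graph_def)

lemma is_algebra_HGraph: "is_algebra HGraph"
  unfolding is_algebra_def
proof (intro conjI allI)
  let ?m = "hmult HGraph"
  note lin = qlinear_comp[OF hmult_HGraph(1)] qlinear_compose qlinear_tens_left qlinear_tens_right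
  fix x y z
  show "?m (?m (x \<otimes> y) \<otimes> z) = ?m (x \<otimes> ?m (y \<otimes> z))"
  proof (rule qlinear_eqI[of "\<lambda>x. ?m (?m (x \<otimes> y) \<otimes> z)"])
    show "?m (?m (bvec a \<otimes> y) \<otimes> z) = ?m (bvec a \<otimes> ?m (y \<otimes> z))" for a
      by (rule bilinear_eqI[of "\<lambda>y z. ?m (?m (bvec a \<otimes> y) \<otimes> z)"]) (simp_all add: lin gprod_assoc)
  qed (simp_all add: lin)
  show "?m (hunit HGraph \<otimes> x) = x"
    by (rule qlinear_eqI[of "\<lambda>x. ?m (hunit HGraph \<otimes> x)"]) (simp_all add: lin hunit_HGraph gprod_empty)
  show "?m (x \<otimes> hunit HGraph) = x"
    by (rule qlinear_eqI[of "\<lambda>x. ?m (x \<otimes> hunit HGraph)"]) (simp_all add: lin hunit_HGraph gprod_empty)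
qed simp

text \<open>
  Both iterated coproducts of \<open>G\<close> run over the ways to cut \<open>V(G)\<close> into three parts.
\<close>

lemma gcoprod_coassoc:
  "tassoc (tmap (hcomult HGraph) id (gcoprod G)) = tmap id (hcomult HGraph) (gcoprod G)"
proof -
  let ?V = "verts G"
  let ?t = "\<lambda>A B C. bvec (grestr G A, (grestr G B, grestr G C))"
  have "tassoc (tmap (hcomult HGraph) id (gcoprod G)) =
      (\<Sum>I\<in>Pow ?V. \<Sum>J\<in>Pow I. ?t J (I - J) (?V - I))"
    unfolding gcoprod_eq[of G]
    by (simp add: qlinear_sum gcoprod_grestr tens_sum_left)
  also have "\<dots> = (\<Sum>(I, J)\<in>Sigma (Pow ?V) Pow. ?t J (I - J) (?V - I))"
    by (rule sum.Sigma) (auto intro: finite_subset)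
  also have "\<dots> = (\<Sum>(A, B)\<in>(SIGMA A:Pow ?V. Pow (?V - A)). ?t A B (?V - A - B))"
    by (rule sum.reindex_bij_witness[of _ "\<lambda>(A, B). (A \<union> B, A)" "\<lambda>(I, J). (J, I - J)"])
       (auto simp: set_diff_eq intro!: arg_cong[of _ _ "grestr G"])
  also have "\<dots> = (\<Sum>A\<in>Pow ?V. \<Sum>B\<in>Pow (?V - A). ?t A B (?V - A - B))"
    by (rule sum.Sigma[symmetric]) auto
  also have "\<dots> = tmap id (hcomult HGraph) (gcoprod G)"
    unfolding gcoprod_eq[of G]
    by (simp add: qlinear_sum gcoprod_grestr tens_sum_right)
  finally show ?thesis .
qed

lemma is_coalgebra_HGraph: "is_coalgebra HGraph"
  unfolding is_coalgebra_def
proof (intro conjI allI)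
  let ?D = "hcomult HGraph"
  note lin = qlinear_comp[OF hcomult_HGraph(1)] qlinear_compose
  show "Vector_Spaces.linear qscale (*) (hcounit HGraph)"
    unfolding hcounit_HGraph[abs_def] by (rule linear_coefficient)
  fix x
  show "tassoc (tmap ?D id (?D x)) = tmap id ?D (?D x)"
  proof (rule qlinear_eqI[of "\<lambda>x. tassoc (tmap ?D id (?D x))"])
    show "tassoc (tmap ?D id (?D (bvec G))) = tmap id ?D (?D (bvec G))" for G
      using gcoprod_coassoc[of G] by simp
  qed (simp_all add: lin)
  let ?l = "lin_ext (\<lambda>(a, b). qscale (hcounit HGraph (bvec a)) (bvec b))"
  show "?l (?D x) = x"
  proof (rule qlinear_eqI[of "\<lambda>x. ?l (?D x)"])
    fix G
    have "?l (gcoprod G) = (\<Sum>I\<in>Pow (verts G). if I = {} then bvec G else 0)"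
      unfolding gcoprod_eq qlinear_sum[OF qlinear_lin_ext]
      by (rule sum.cong) (auto simp: hcounit_HGraph lookup_bvec gsize_grestr_0 grestr_verts)
    then show "?l (?D (bvec G)) = bvec G" by (simp add: sum.delta)
  qed (simp_all add: lin)
  let ?l = "lin_ext (\<lambda>(a, b). qscale (hcounit HGraph (bvec b)) (bvec a))"
  show "?l (?D x) = x"
  proof (rule qlinear_eqI[of "\<lambda>x. ?l (?D x)"])
    fix G
    have "?l (gcoprod G) = (\<Sum>I\<in>Pow (verts G). if I = verts G then bvec G else 0)"
      unfolding gcoprod_eq qlinear_sum[OF qlinear_lin_ext]
      by (rule sum.cong) (auto simp: hcounit_HGraph lookup_bvec gsize_grestr_0 grestr_verts)
    then show "?l (?D (bvec G)) = bvec G" by (simp add: sum.delta)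
  qed (simp_all add: lin)
qed simp

text \<open>
  A set of vertices of \<open>G H\<close> is a set of vertices of \<open>G\<close> together with a shifted set of vertices of \<open>H\<close>,
  and no edge joins the two.
\<close>

lemma gcoprod_gprod:
  "gcoprod (gprod G H) = tmap (hmult HGraph) (hmult HGraph) (tmiddle (gcoprod G \<otimes> gcoprod H))"
proof -
  let ?sh = "\<lambda>x. x + gsize G"
  let ?U = "\<lambda>(I, J). I \<union> ?sh ` J"
  let ?P = "Pow (verts G) \<times> Pow (verts H)"
  have disj: "x \<noteq> ?sh y" if "x \<in> verts G" "y \<in> verts H" for x y
    using that by (auto simp: verts_def)
  have compl: "verts (gprod G H) - ?U (I, J) = ?U (verts G - I, verts H - J)"
    if "I \<subseteq> verts G" "J \<subseteq> verts H" for I J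
    using that disj unfolding verts_gprod by auto
  have bij: "bij_betw ?U ?P (Pow (verts (gprod G H)))"
  proof (rule bij_betw_byWitness[where f' = "\<lambda>K. (K \<inter> verts G, {y \<in> verts H. ?sh y \<in> K})"])
    show "?U ` ?P \<subseteq> Pow (verts (gprod G H))" by (auto simp: verts_gprod)
  qed (use disj in \<open>auto simp: verts_gprod\<close>)
  have "gcoprod (gprod G H) = (\<Sum>p\<in>?P. bvec (grestr (gprod G H) (?U p),
      grestr (gprod G H) (verts (gprod G H) - ?U p)))"
    unfolding gcoprod_eq[of "gprod G H"] by (rule sum.reindex_bij_betw[OF bij, symmetric])
  also have "\<dots> = (\<Sum>(I, J)\<in>?P. bvec (gprod (grestr G I) (grestr H J),
      gprod (grestr G (verts G - I)) (grestr H (verts H - J))))"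
  proof (rule sum.cong[OF refl])
    fix p assume "p \<in> ?P"
    then obtain I J where p: "p = (I, J)" "I \<subseteq> verts G" "J \<subseteq> verts H" by auto
    then show "bvec (grestr (gprod G H) (?U p), grestr (gprod G H) (verts (gprod G H) - ?U p)) =
        (case p of (I, J) \<Rightarrow> bvec (gprod (grestr G I) (grestr H J),
          gprod (grestr G (verts G - I)) (grestr H (verts H - J))))"
      using compl[OF p(2,3)] grestr_gprod[of I G J H] grestr_gprod[of "verts G - I" G "verts H - J" H]
      by simp
  qed
  also have "\<dots> = tmap (hmult HGraph) (hmult HGraph) (tmiddle (gcoprod G \<otimes> gcoprod H))"
    unfolding gcoprod_eq sum.cartesian_product[symmetric]
    by (simp add: tens_sum_left tens_sum_right qlinear_sum, rule sum.swap)
  finally show ?thesis .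
qed

lemma is_bialgebra_HGraph: "is_bialgebra HGraph"
  unfolding is_bialgebra_def
proof (intro conjI allI is_algebra_HGraph is_coalgebra_HGraph)
  let ?m = "hmult HGraph" and ?D = "hcomult HGraph"
  note lin = qlinear_comp[OF hcomult_HGraph(1)] qlinear_comp[OF hmult_HGraph(1)] qlinear_compose
     qlinear_tens_left qlinear_tens_right
  fix x y
  show "?D (?m (x \<otimes> y)) = tmap ?m ?m (tmiddle (?D x \<otimes> ?D y))"
    by (rule bilinear_eqI[of "\<lambda>x y. ?D (?m (x \<otimes> y))"]) (simp_all add: lin gcoprod_gprod)
  have "Poly_Mapping.lookup (?m t) empty_graph = (\<Sum>i\<in>{()}. Poly_Mapping.lookup t (empty_graph, empty_graph))" for t
    by (rule lookup_pullback) (auto simp: lookup_bvec gsize_gprod simp flip: gsize_0_iff)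
  then show "hcounit HGraph (?m (x \<otimes> y)) = hcounit HGraph x * hcounit HGraph y"
    by (simp add: hcounit_HGraph lookup_tens)
  show "?D (hunit HGraph) = hunit HGraph \<otimes> hunit HGraph"
    by (simp add: hunit_HGraph gcoprod_eq verts_def gsize_grestr_0)
  show "hcounit HGraph (hunit HGraph) = 1"
    by (simp add: hunit_HGraph hcounit_HGraph lookup_bvec)
qed

lemma is_hopf_algebra_HGraph: "is_hopf_algebra HGraph"
proof (rule graded_connected_hopf[where deg = gsize and e = empty_graph])
  fix a b c assume "(b, c) \<in> Poly_Mapping.keys (hcomult HGraph (bvec a))"
  then obtain I where "I \<subseteq> verts a" "b = grestr a I" "c = grestr a (verts a - I)"
    using keys_sum_bvec[of "\<lambda>I. (grestr a I, grestr a (verts a - I))" "Pow (verts a)"]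
    by (auto simp: gcoprod_eq)
  then show "gsize b + gsize c = gsize a"
    using card_mono[of "verts a" I] by (simp add: gsize_grestr card_Diff_subset finite_subset)
qed (simp_all add: is_bialgebra_HGraph hunit_HGraph hcounit_HGraph gsize_0_iff)

text \<open>Exchanging the two tensor factors exchanges \<open>I\<close> and its complement.\<close>

lemma gcoprod_cocommutative: "tswap (gcoprod G) = gcoprod G"
proof -
  have "tswap (gcoprod G) = (\<Sum>I\<in>Pow (verts G). bvec (grestr G (verts G - I), grestr G I))"
    by (simp add: gcoprod_eq qlinear_sum)
  also have "\<dots> = gcoprod G"
    unfolding gcoprod_eq
    by (rule sum.reindex_bij_witness[of _ "\<lambda>I. verts G - I" "\<lambda>I. verts G - I"])
       (auto simp: double_diff)
  finally show ?thesis .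
qed

section \<open>Packing and splitting words\<close>

lemma wlen_Pack [simp]: "wlen (Pack u) = length u"
  by (simp add: wlen_def word_of_Pack Pack_list_def)

lemma Pack_map:
  assumes "strict_mono_on (set u) f"
  shows "Pack (map f u) = Pack u"
proof -
  have "map (rank (f ` set u)) (map f u) = map (rank (set u)) u"
    using rank_image[OF assms] by simp
  then show ?thesis unfolding Pack_def Pack_list_def list.set_map by (rule arg_cong)
qed

lemma Pack_word_of [simp]: "Pack (word_of w) = w"
proof -
  have "map (rank (set (word_of w))) (word_of w) = word_of w"
    by (rule map_idI) (use rank_interval in \<open>auto simp: set_word_of\<close>)
  then show ?thesis by (simp add: Pack_def Pack_list_def word_of_inverse)
qed

lemma word_of_nonzero: "x \<in> set (word_of w) \<Longrightarrow> 0 < x"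
  by (simp add: set_word_of)

lemma Pack_eq_imp_increasing_map:
  assumes "Pack y = Pack u"
  obtains g where "strict_mono_on (set y) g" "map g y = u"
proof
  let ?r = "rank (set u)" and ?s = "rank (set y)"
  let ?g = "\<lambda>c. inv_into (set u) ?r (?s c)"
  have inj: "inj_on ?r (set u)"
    by (rule strict_mono_on_imp_inj_on[OF rank_strict_mono]) simp
  have eq: "map ?s y = map ?r u"
    using assms by (metis Pack_list_def word_of_Pack)
  have "map ?g y = map (inv_into (set u) ?r) (map ?s y)" by simp
  also have "\<dots> = u"
    unfolding eq using inj by (simp add: map_idI)
  finally show "map ?g y = u" .
  have im: "?s ` set y = ?r ` set u"
    using eq by (metis list.set_map)
  show "strict_mono_on (set y) ?g"
  proof (rule strict_mono_onI)
    fix c d assume cd: "c \<in> set y" "d \<in> set y" "c < d"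
    then have "?s c < ?s d" by (intro strict_mono_onD[OF rank_strict_mono]) auto
    moreover have "?s c \<in> ?r ` set u" "?s d \<in> ?r ` set u" using cd im by auto
    ultimately have "?g c \<in> set u" "?g d \<in> set u" "?r (?g c) < ?r (?g d)"
      by (auto simp: f_inv_into_f inv_into_into)
    then show "?g c < ?g d"
      using strict_mono_on_less[OF rank_strict_mono] by blast
  qed
qed

definition splits :: "'a list \<Rightarrow> ('a list \<times> 'a list) set" where
  "splits u = {(p, q). p @ q = u}"

lemma splits_eq: "splits u = (\<lambda>n. (take n u, drop n u)) ` {..length u}"
proof
  show "splits u \<subseteq> (\<lambda>n. (take n u, drop n u)) ` {..length u}"
  proof
    fix i assume "i \<in> splits u"
    then show "i \<in> (\<lambda>n. (take n u, drop n u)) ` {..length u}"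
      by (intro image_eqI[of _ _ "length (fst i)"]) (auto simp: splits_def)
  qed
qed (auto simp: splits_def)

lemma finite_splits [simp]: "finite (splits u)"
  by (simp add: splits_eq)

lemma sum_splits: "sum f (splits u) = (\<Sum>n\<le>length u. f (take n u, drop n u))"
proof -
  have "inj_on (\<lambda>n. (take n u, drop n u)) {..length u}"
    by (rule inj_on_inverseI[where g = "\<lambda>(p, q). length p"]) simp
  then show ?thesis by (simp add: splits_eq sum.reindex)
qed

lemma splits_Nil [simp]: "splits [] = {([], [])}"
  by (auto simp: splits_def)

text \<open>
  The words \<open>v\<close> that are shuffles of \<open>u1\<close> and \<open>u2\<close>, when the letters of \<open>u1\<close> are at most \<open>m\<close> and
  those of \<open>u2\<close> are larger.
\<close>

definition merges :: "nat \<Rightarrow> nat list \<Rightarrow> nat list \<Rightarrow> nat list set" where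
  "merges m u1 u2 = {v. filter (\<lambda>x. x \<le> m) v = u1 \<and> filter (\<lambda>x. m < x) v = u2}"

lemma set_merges: "v \<in> merges m u1 u2 \<Longrightarrow> set v = set u1 \<union> set u2"
  by (auto simp: merges_def)

lemma length_merges: "v \<in> merges m u1 u2 \<Longrightarrow> length v = length u1 + length u2"
  using sum_length_filter_compl[of "\<lambda>x. x \<le> m" v] by (auto simp: merges_def not_le)

lemma finite_merges [simp]: "finite (merges m u1 u2)"
  by (rule finite_subset[OF _ finite_lists_length_eq[of "set u1 \<union> set u2" "length u1 + length u2"]])
     (auto simp: set_merges length_merges)

lemma merges_Nil_left: "\<forall>x\<in>set u. m < x \<Longrightarrow> merges m [] u = {u}"
  by (auto simp: merges_def filter_empty_conv filter_id_conv not_le)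

lemma merges_Nil_right: "\<forall>x\<in>set u. x \<le> m \<Longrightarrow> merges m u [] = {u}"
  by (auto simp: merges_def filter_empty_conv filter_id_conv not_less)

text \<open>
  Every pair of packed words has representatives that are separated: the letters of the second word
  can be shifted. The coproduct is described at such pairs, because then a shuffle determines
  which of its letters come from which word.
\<close>

definition separated :: "nat \<Rightarrow> nat list \<Rightarrow> nat list \<Rightarrow> bool" where
  "separated m u1 u2 \<longleftrightarrow> (\<forall>x\<in>set u1. x \<le> m) \<and> (\<forall>x\<in>set u2. m < x)"

section \<open>The coefficients of products and coproducts of words\<close>

lemma hmult_WQSym [simp]: "qlinear (hmult WQSym)" "hmult WQSym (bvec (w, w')) = wprod w w'"
  and hcomult_WQSym [simp]: "qlinear (hcomult WQSym)" "hcomult WQSym (bvec w) = wcoprod w"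
  and hunit_WQSym: "hunit WQSym = bvec (Pack [])"
  and hcounit_WQSym: "hcounit WQSym x = Poly_Mapping.lookup x (Pack [])"
  by (simp_all add: WQSym_def Pack_def Pack_list_def)

lemma Pack_eq_Nil [simp]: "Pack u = Pack [] \<longleftrightarrow> u = []" "Pack [] = Pack u \<longleftrightarrow> u = []"
  by (metis length_0_conv wlen_Pack)+

text \<open>
  The only cut of \<open>u\<close> that can contribute is the one after as many letters as \<open>a\<close> has. The sum over all
  cuts, in which the length of \<open>a\<close> does not occur, is a formula that extends to linear combinations.
\<close>

lemma lookup_wprod:
  "Poly_Mapping.lookup (wprod a b) (Pack u) =
    (\<Sum>i\<in>splits u. of_bool ((a, b) = (Pack (fst i), Pack (snd i))))"
proof -
  let ?C = "wlen (Pack u) = wlen a + wlen b \<and>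
    Pack (take (wlen a) (word_of (Pack u))) = a \<and> Pack (drop (wlen a) (word_of (Pack u))) = b"
  let ?R = "Pack (take (wlen a) u) = a \<and> Pack (drop (wlen a) u) = b"
  have mono: "strict_mono_on (set p) (rank (set u))" if "set p \<subseteq> set u" for p
    using monotone_on_subset[OF rank_strict_mono that] by simp
  have cut: "Pack (take n (word_of (Pack u))) = Pack (take n u)"
    "Pack (drop n (word_of (Pack u))) = Pack (drop n u)" for n
    by (simp_all add: word_of_Pack Pack_list_def take_map drop_map Pack_map mono set_take_subset set_drop_subset)
  have "length u = wlen a + wlen b" if ?R "wlen a \<le> length u"
  proof -
    have "wlen b = length (drop (wlen a) u)" using that(1) by (metis wlen_Pack)
    with that(2) show ?thesis by simp
  qed
  then have C_iff: "?C \<longleftrightarrow> wlen a \<le> length u \<and> ?R"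
    unfolding cut wlen_Pack using le_add1 by metis
  have "finite {w. wlen w = wlen a + wlen b \<and> Pack (take (wlen a) (word_of w)) = a \<and>
      Pack (drop (wlen a) (word_of w)) = b}"
    by (rule finite_subset[OF _ finite_words_of_length[of "wlen a + wlen b"]]) auto
  then have "Poly_Mapping.lookup (wprod a b) (Pack u) = of_bool ?C"
    by (simp add: wprod_def lookup_sum lookup_bvec of_bool_def sum.delta)
  also have "\<dots> = of_bool (wlen a \<le> length u \<and> ?R)" unfolding C_iff ..
  also have "\<dots> = (\<Sum>n\<le>length u. if n = wlen a then of_bool ?R else 0 :: rat)"
    by (simp add: sum.delta)
  also have "\<dots> = (\<Sum>n\<le>length u. of_bool ((a, b) = (Pack (take n u), Pack (drop n u))))"
  proof (rule sum.cong[OF refl])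
    fix n assume "n \<in> {..length u}"
    then have "n = wlen a" if "a = Pack (take n u)" using that by simp
    then have iff: "(a, b) = (Pack (take n u), Pack (drop n u)) \<longleftrightarrow> n = wlen a \<and> ?R"
      unfolding prod.inject by metis
    show "(if n = wlen a then of_bool ?R else 0 :: rat) =
        of_bool ((a, b) = (Pack (take n u), Pack (drop n u)))"
      unfolding iff by (cases "n = wlen a") (simp_all only: if_True if_False simp_thms of_bool_eq)
  qed
  finally show ?thesis by (simp add: sum_splits)
qed

lemma lookup_hmult_WQSym:
  "Poly_Mapping.lookup (hmult WQSym t) (Pack u) =
    (\<Sum>i\<in>splits u. Poly_Mapping.lookup t (Pack (fst i), Pack (snd i)))"
  by (rule lookup_pullback) (auto simp: lookup_wprod split: prod.splits)

text \<open>All shuffles of \<open>u1\<close> and \<open>u2\<close> have the same letters, so packing applies the same injection to each.\<close>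

lemma inj_on_Pack_merges: "inj_on Pack (merges m u1 u2)"
proof
  fix v v' assume *: "v \<in> merges m u1 u2" "v' \<in> merges m u1 u2" "Pack v = Pack v'"
  then have S: "set v = set v'" by (simp add: set_merges)
  have "map (rank (set v)) v = map (rank (set v)) v'"
    using *(3) S by (metis Pack_list_def word_of_Pack)
  moreover have "inj_on (rank (set v)) (set v \<union> set v')"
    using strict_mono_on_imp_inj_on[OF rank_strict_mono] S by auto
  ultimately show "v = v'" by (simp add: inj_on_map_eq_map)
qed

text \<open>
  Packing a shuffle sends its letters up to \<open>m\<close>, those of \<open>u1\<close>, to the letters up to \<open>i\<close>, which
  gives one direction. Conversely, increasing maps that turn the two
  parts of \<open>w\<close> into \<open>u1\<close> and \<open>u2\<close> can be glued to one increasing map, as \<open>m\<close> separates their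
  values; it turns \<open>w\<close> into a shuffle.
\<close>

lemma merges_Pack_iff:
  assumes "separated m u1 u2"
  defines "i \<equiv> card (set u1)"
  shows "(\<exists>v\<in>merges m u1 u2. Pack v = w) \<longleftrightarrow>
    i \<le> wmax w \<and> filter (\<lambda>x. x \<le> i) (word_of w) = word_of (Pack u1) \<and>
      Pack (filter (\<lambda>x. i < x) (word_of w)) = Pack u2" (is "?L \<longleftrightarrow> ?R")
proof
  assume ?L
  then obtain v where v: "v \<in> merges m u1 u2" "w = Pack v" by blast
  let ?S = "set u1 \<union> set u2" and ?r = "rank (set u1 \<union> set u2)"
  have S: "set v = ?S" using v by (simp add: set_merges)
  have w: "word_of w = map ?r v" by (simp add: v(2) word_of_Pack Pack_list_def S)
  have disj: "set u1 \<inter> set u2 = {}" using assms(1) by (force simp: separated_def)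
  have small: "?r x = rank (set u1) x" if "x \<in> set u1" for x
    using assms(1) that by (intro rank_append_left) (force simp: separated_def)
  have large: "?r x = i + rank (set u2) x" if "x \<in> set u2" for x
    unfolding i_def using assms(1) that disj by (intro rank_append_right) (force simp: separated_def)+
  have thr: "?r x \<le> i \<longleftrightarrow> x \<le> m" if "x \<in> ?S" for x
  proof (cases "x \<in> set u1")
    case True
    then show ?thesis using assms(1) rank_bij[of "set u1"]
      by (auto simp: small separated_def bij_betw_def i_def)
  next
    case False
    then have "x \<in> set u2" using that by simp
    moreover have "rank (set u2) x \<in> {1..card (set u2)}"
      using rank_bij[of "set u2"] \<open>x \<in> set u2\<close> by (auto simp: bij_betw_def)
    ultimately show ?thesis using assms(1) large by (auto simp: separated_def)
  qed
  have "filter (\<lambda>x. x \<le> i) (word_of w) = map ?r (filter (\<lambda>x. x \<le> m) v)"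
    unfolding w filter_map by (rule arg_cong[of _ _ "map ?r"], rule filter_cong) (auto simp: thr S)
  also have "\<dots> = word_of (Pack u1)"
    using v by (simp add: merges_def word_of_Pack Pack_list_def small)
  finally have 1: "filter (\<lambda>x. x \<le> i) (word_of w) = word_of (Pack u1)" .
  have "filter (\<lambda>x. i < x) (word_of w) = map ?r (filter (\<lambda>x. m < x) v)"
    unfolding w filter_map by (rule arg_cong[of _ _ "map ?r"], rule filter_cong) (auto simp: thr S simp flip: not_le)
  also have "\<dots> = map ?r u2" using v by (simp add: merges_def)
  also have "Pack \<dots> = Pack u2"
    by (rule Pack_map, rule monotone_on_subset[OF rank_strict_mono]) auto
  finally have 2: "Pack (filter (\<lambda>x. i < x) (word_of w)) = Pack u2" .
  have "{1..wmax w} = {1..card ?S}"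
    unfolding v(2) set_word_of[symmetric] word_of_Pack set_Pack_list S ..
  then have "card {1..wmax w} = card {1..card ?S}" by (rule arg_cong)
  then have "wmax w = card ?S" by simp
  then have "i \<le> wmax w" unfolding i_def by (simp add: card_mono)
  with 1 2 show ?R by simp
next
  assume ?R
  let ?y1 = "filter (\<lambda>x. x \<le> i) (word_of w)" and ?y2 = "filter (\<lambda>x. i < x) (word_of w)"
  from \<open>?R\<close> have "Pack ?y1 = Pack u1" by simp
  then obtain g1 where g1: "strict_mono_on (set ?y1) g1" "map g1 ?y1 = u1"
    by (rule Pack_eq_imp_increasing_map)
  from \<open>?R\<close> have "Pack ?y2 = Pack u2" by simp
  then obtain g2 where g2: "strict_mono_on (set ?y2) g2" "map g2 ?y2 = u2"
    by (rule Pack_eq_imp_increasing_map)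
  let ?g = "\<lambda>c. if c \<le> i then g1 c else g2 c"
  have le: "g1 c \<le> m" if "c \<in> set (word_of w)" "c \<le> i" for c
    using assms(1) g1(2) that by (auto simp: separated_def)
  have gt: "m < g2 c" if "c \<in> set (word_of w)" "\<not> c \<le> i" for c
    using assms(1) g2(2) that by (auto simp: separated_def)
  have "strict_mono_on (set (word_of w)) ?g"
  proof (rule strict_mono_onI)
    fix c d assume "c \<in> set (word_of w)" "d \<in> set (word_of w)" "c < d"
    then show "?g c < ?g d"
      using strict_mono_onD[OF g1(1), of c d] strict_mono_onD[OF g2(1), of c d] le[of c] gt[of d]
      by auto
  qed
  then have "Pack (map ?g (word_of w)) = w" by (simp add: Pack_map)
  moreover have "map ?g (word_of w) \<in> merges m u1 u2"
  proof -
    have thr: "?g c \<le> m \<longleftrightarrow> c \<le> i" if "c \<in> set (word_of w)" for c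
      using le[OF that] gt[OF that] by auto
    have "filter (\<lambda>x. x \<le> m) (map ?g (word_of w)) = map ?g ?y1"
      unfolding filter_map by (rule arg_cong[of _ _ "map ?g"], rule filter_cong) (use thr in auto)
    also have "\<dots> = map g1 ?y1" by (rule map_cong) auto
    finally have 1: "filter (\<lambda>x. x \<le> m) (map ?g (word_of w)) = u1" unfolding g1(2) .
    have "filter (\<lambda>x. m < x) (map ?g (word_of w)) = map ?g ?y2"
      unfolding filter_map by (rule arg_cong[of _ _ "map ?g"], rule filter_cong) (use thr in \<open>auto simp flip: not_le\<close>)
    also have "\<dots> = map g2 ?y2" by (rule map_cong) auto
    finally show ?thesis using 1 g2(2) by (simp add: merges_def)
  qed
  ultimately show ?L by blast
qed

text \<open>
  Only one summand of the coproduct of \<open>w\<close> can have \<open>Pack u1\<close> as left factor: the one that cuts the alphabet after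
  as many letters as occur in \<open>u1\<close>.
\<close>

lemma lookup_wcoprod:
  assumes "separated m u1 u2"
  shows "Poly_Mapping.lookup (wcoprod w) (Pack u1, Pack u2) = (\<Sum>v\<in>merges m u1 u2. of_bool (w = Pack v))"
proof -
  let ?u = "word_of w" and ?i = "card (set u1)"
  let ?C = "filter (\<lambda>x. x \<le> ?i) ?u = word_of (Pack u1) \<and> Pack (filter (\<lambda>x. ?i < x) ?u) = Pack u2"
  have low: "restr_letters ?u {1..j} = filter (\<lambda>x. x \<le> j) ?u" for j
    unfolding restr_letters_def by (rule filter_cong) (auto dest: word_of_nonzero)
  have high: "restr_letters ?u ({1..wmax w} - {1..j}) = filter (\<lambda>x. j < x) ?u" for j
    unfolding restr_letters_def by (rule filter_cong) (auto simp: set_word_of)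
  have summand: "Poly_Mapping.lookup (bvec (PWord (restr_letters ?u {1..j}),
        Pack (restr_letters ?u ({1..wmax w} - {1..j})))) (Pack u1, Pack u2) =
      (if j = ?i then of_bool ?C else 0)" if "j \<in> {0..wmax w}" for j
  proof -
    have j: "word_of (PWord (restr_letters ?u {1..j})) = filter (\<lambda>x. x \<le> j) ?u"
    proof -
      have "j \<le> wmax w" using that by simp
      from word_of_initial[OF this] show ?thesis unfolding low .
    qed
    have iff: "PWord (restr_letters ?u {1..j}) = Pack u1 \<longleftrightarrow> filter (\<lambda>x. x \<le> j) ?u = word_of (Pack u1)"
      unfolding j[symmetric] word_of_inject ..
    have j_eq: "j = ?i" if "filter (\<lambda>x. x \<le> j) ?u = word_of (Pack u1)"
    proof -
      have "{1..j} = set (filter (\<lambda>x. x \<le> j) ?u)"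
        using \<open>j \<in> {0..wmax w}\<close> by (auto simp: set_word_of)
      also have "\<dots> = {1..?i}" unfolding that word_of_Pack set_Pack_list ..
      finally have "card {1..j} = card {1..?i}" by (rule arg_cong)
      then show ?thesis by simp
    qed
    show ?thesis
    proof (cases "j = ?i")
      case True
      show ?thesis unfolding lookup_bvec prod.inject iff high unfolding True by (simp only: if_True simp_thms)
    next
      case False
      with j_eq have "filter (\<lambda>x. x \<le> j) ?u \<noteq> word_of (Pack u1)" by blast
      with False show ?thesis unfolding lookup_bvec prod.inject iff by (simp only: if_False simp_thms of_bool_eq)
    qed
  qed
  have "Poly_Mapping.lookup (wcoprod w) (Pack u1, Pack u2) =
      (\<Sum>j\<in>{0..wmax w}. if j = ?i then of_bool ?C else 0)"
    unfolding wcoprod_def lookup_sum tens_bvec by (rule sum.cong[OF refl summand])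
  also have "\<dots> = of_bool (?i \<le> wmax w \<and> ?C)" by (auto simp: sum.delta)
  also have "\<dots> = of_bool (\<exists>v\<in>merges m u1 u2. Pack v = w)"
    by (simp only: merges_Pack_iff[OF assms])
  also have "\<dots> = (\<Sum>v\<in>merges m u1 u2. of_bool (w = Pack v))"
  proof (cases "\<exists>v\<in>merges m u1 u2. Pack v = w")
    case True
    then obtain v where v: "v \<in> merges m u1 u2" "w = Pack v" by blast
    then have "w = Pack v' \<longleftrightarrow> v' = v" if "v' \<in> merges m u1 u2" for v'
      using inj_onD[OF inj_on_Pack_merges] that by blast
    then have "(\<Sum>v'\<in>merges m u1 u2. of_bool (w = Pack v')) = (\<Sum>v'\<in>merges m u1 u2. of_bool (v' = v) :: rat)"
      by (intro sum.cong) auto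
    also have "\<dots> = 1" using v(1) by (simp add: of_bool_def sum.delta)
    finally show ?thesis using True by simp
  qed (auto intro!: sum.neutral)
  finally show ?thesis .
qed

lemma lookup_hcomult_WQSym:
  assumes "separated m u1 u2"
  shows "Poly_Mapping.lookup (hcomult WQSym x) (Pack u1, Pack u2) =
    (\<Sum>v\<in>merges m u1 u2. Poly_Mapping.lookup x (Pack v))"
  by (rule lookup_pullback) (simp_all add: lookup_wcoprod[OF assms])

section \<open>The Hopf algebra of packed words\<close>

lemma shifted_word: 
  obtains u where "w = Pack u" "\<forall>x\<in>set u. m < x"
proof
  show "w = Pack (map (\<lambda>x. x + m) (word_of w))"
    by (subst Pack_map) (auto simp: strict_mono_on_def)
  show "\<forall>x\<in>set (map (\<lambda>x. x + m) (word_of w)). m < x"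
    by (auto dest: word_of_nonzero)
qed

lemma word_bound: "\<exists>m. \<forall>x\<in>set u. x \<le> (m :: nat)"
  by (rule exI[of _ "Max (set u)"]) simp

lemma separated_words:
  obtains m u1 u2 where "a = Pack u1" "b = Pack u2" "separated m u1 u2"
proof -
  obtain m where "\<forall>x\<in>set (word_of a). x \<le> m" using word_bound by blast
  moreover obtain u2 where "b = Pack u2" "\<forall>x\<in>set u2. m < x" by (rule shifted_word)
  ultimately show thesis by (intro that[of "word_of a" u2 m]) (simp_all add: separated_def)
qed

lemma WQSym_eqI:
  assumes "\<And>u. Poly_Mapping.lookup x (Pack u) = Poly_Mapping.lookup y (Pack u)"
  shows "x = y"
  by (rule poly_mapping_eqI) (metis assms Pack_word_of)

lemma WQSym_tens_eqI:
  assumes "\<And>m u1 u2. separated m u1 u2 \<Longrightarrow>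
    Poly_Mapping.lookup x (Pack u1, Pack u2) = Poly_Mapping.lookup y (Pack u1, Pack u2)"
  shows "x = y"
proof (rule poly_mapping_eqI)
  fix ab :: "packed_word \<times> packed_word"
  obtain m u1 u2 where "fst ab = Pack u1" "snd ab = Pack u2" "separated m u1 u2"
    by (rule separated_words)
  with assms show "Poly_Mapping.lookup x ab = Poly_Mapping.lookup y ab" by (cases ab) auto
qed

lemma is_algebra_WQSym: "is_algebra WQSym"
  unfolding is_algebra_def
proof (intro conjI allI)
  let ?m = "hmult WQSym"
  fix x y z :: "packed_word \<Rightarrow>\<^sub>0 rat"
  let ?x = "Poly_Mapping.lookup x" and ?y = "Poly_Mapping.lookup y" and ?z = "Poly_Mapping.lookup z"
  show "?m (?m (x \<otimes> y) \<otimes> z) = ?m (x \<otimes> ?m (y \<otimes> z))"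
  proof (rule WQSym_eqI)
    fix u
    let ?t = "\<lambda>p q r. ?x (Pack p) * ?y (Pack q) * ?z (Pack r)"
    have "Poly_Mapping.lookup (?m (?m (x \<otimes> y) \<otimes> z)) (Pack u) =
        (\<Sum>i\<in>splits u. \<Sum>j\<in>splits (fst i). ?t (fst j) (snd j) (snd i))"
      by (simp add: lookup_hmult_WQSym lookup_tens sum_distrib_right)
    also have "\<dots> = (\<Sum>(i, j)\<in>(SIGMA i:splits u. splits (fst i)). ?t (fst j) (snd j) (snd i))"
      by (rule sum.Sigma) auto
    also have "\<dots> = (\<Sum>(i, j)\<in>(SIGMA i:splits u. splits (snd i)). ?t (fst i) (fst j) (snd j))"
      by (rule sum.reindex_bij_witness[of _ "\<lambda>((p, qr), (q, r)). ((p @ q, r), (p, q))"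
            "\<lambda>((pq, r), (p, q)). ((p, q @ r), (q, r))"]) (auto simp: splits_def)
    also have "\<dots> = (\<Sum>i\<in>splits u. \<Sum>j\<in>splits (snd i). ?t (fst i) (fst j) (snd j))"
      by (rule sum.Sigma[symmetric]) auto
    also have "\<dots> = Poly_Mapping.lookup (?m (x \<otimes> ?m (y \<otimes> z))) (Pack u)"
      by (simp add: lookup_hmult_WQSym lookup_tens sum_distrib_left mult.assoc)
    finally show "Poly_Mapping.lookup (?m (?m (x \<otimes> y) \<otimes> z)) (Pack u) =
        Poly_Mapping.lookup (?m (x \<otimes> ?m (y \<otimes> z))) (Pack u)" .
  qed
  show "?m (hunit WQSym \<otimes> x) = x"
  proof (rule WQSym_eqI)
    fix u
    have "Poly_Mapping.lookup (?m (hunit WQSym \<otimes> x)) (Pack u) =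
        (\<Sum>n\<le>length u. if n = 0 then ?x (Pack u) else 0)"
      unfolding lookup_hmult_WQSym sum_splits
      by (rule sum.cong) (auto simp: hunit_WQSym lookup_tens lookup_bvec)
    then show "Poly_Mapping.lookup (?m (hunit WQSym \<otimes> x)) (Pack u) = ?x (Pack u)"
      by (simp add: sum.delta)
  qed
  show "?m (x \<otimes> hunit WQSym) = x"
  proof (rule WQSym_eqI)
    fix u
    have "Poly_Mapping.lookup (?m (x \<otimes> hunit WQSym)) (Pack u) =
        (\<Sum>n\<le>length u. if n = length u then ?x (Pack u) else 0)"
      unfolding lookup_hmult_WQSym sum_splits
      by (rule sum.cong) (auto simp: hunit_WQSym lookup_tens lookup_bvec)
    then show "Poly_Mapping.lookup (?m (x \<otimes> hunit WQSym)) (Pack u) = ?x (Pack u)"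
      by (simp add: sum.delta)
  qed
qed simp

lemma lookup_id: "Poly_Mapping.lookup (id x) c = (\<Sum>i\<in>{()}. Poly_Mapping.lookup x c)"
  by simp

text \<open>
  Both iterated coproducts have as coefficient the sum over the words whose letters fall into three
  ranges and restrict to the three given words.
\<close>

lemma WQSym_coassoc:
  "tassoc (tmap (hcomult WQSym) id (hcomult WQSym x)) = tmap id (hcomult WQSym) (hcomult WQSym x)"
proof (rule poly_mapping_eqI)
  let ?D = "hcomult WQSym" and ?x = "Poly_Mapping.lookup x"
  fix abc :: "packed_word \<times> (packed_word \<times> packed_word)"
  obtain a b c where abc: "abc = (a, (b, c))" by (metis surj_pair)
  obtain m u1 u2 where a: "a = Pack u1" and b: "b = Pack u2" and sep: "separated m u1 u2"
    by (rule separated_words)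
  obtain n0 where "\<forall>x\<in>set u2. x \<le> n0" using word_bound by blast
  then obtain n where n: "m \<le> n" "\<forall>x\<in>set u2. x \<le> n"
    by (intro that[of "max m n0"]) auto
  obtain u3 where c: "c = Pack u3" and u3: "\<forall>x\<in>set u3. n < x" by (rule shifted_word)
  have sep12: "separated n v u3" if "v \<in> merges m u1 u2" for v
    using set_merges[OF that] sep n u3 by (auto simp: separated_def)
  have sep23: "separated m u1 v" if "v \<in> merges n u2 u3" for v
    using set_merges[OF that] sep n u3 by (auto simp: separated_def)
  have sep': "separated n u2 u3" using n u3 by (simp add: separated_def)
  have "Poly_Mapping.lookup (tassoc (tmap ?D id (?D x))) abc =
      (\<Sum>v\<in>merges m u1 u2. \<Sum>_\<in>{()}. Poly_Mapping.lookup (?D x) (Pack v, Pack u3))"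
    unfolding abc a b c lookup_tassoc
    by (rule lookup_tmap[OF lookup_hcomult_WQSym[OF sep] lookup_id])
  also have "\<dots> = (\<Sum>v\<in>merges m u1 u2. \<Sum>w\<in>merges n v u3. ?x (Pack w))"
    by (rule sum.cong) (simp_all add: lookup_hcomult_WQSym[OF sep12])
  also have "\<dots> = (\<Sum>(v, w)\<in>(SIGMA v:merges m u1 u2. merges n v u3). ?x (Pack w))"
    by (rule sum.Sigma) auto
  also have "\<dots> = (\<Sum>(v, w)\<in>(SIGMA v:merges n u2 u3. merges m u1 v). ?x (Pack w))"
  proof (rule sum.reindex_bij_witness[of _ "\<lambda>(v, w). (filter (\<lambda>x. x \<le> n) w, w)"
            "\<lambda>(v, w). (filter (\<lambda>x. m < x) w, w)"])
    have "x \<le> m \<and> x \<le> n \<longleftrightarrow> x \<le> m" "n < x \<and> m < x \<longleftrightarrow> n < x"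
         "x \<le> n \<and> x \<le> m \<longleftrightarrow> x \<le> m" "m < x \<and> n < x \<longleftrightarrow> n < x"
         "m < x \<and> x \<le> n \<longleftrightarrow> x \<le> n \<and> m < x" for x
      using n by auto
    note simps = merges_def filter_filter this
    fix p
    show "(case case p of (v, w) \<Rightarrow> (filter (\<lambda>x. m < x) w, w) of (v, w) \<Rightarrow> (filter (\<lambda>x. x \<le> n) w, w)) = p"
      "(case p of (v, w) \<Rightarrow> (filter (\<lambda>x. m < x) w, w)) \<in> (SIGMA v:merges n u2 u3. merges m u1 v)"
      if "p \<in> (SIGMA v:merges m u1 u2. merges n v u3)"
      using that by (auto simp: simps)
    show "(case case p of (v, w) \<Rightarrow> (filter (\<lambda>x. x \<le> n) w, w) of (v, w) \<Rightarrow> (filter (\<lambda>x. m < x) w, w)) = p"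
      "(case p of (v, w) \<Rightarrow> (filter (\<lambda>x. x \<le> n) w, w)) \<in> (SIGMA v:merges m u1 u2. merges n v u3)"
      if "p \<in> (SIGMA v:merges n u2 u3. merges m u1 v)"
      using that by (auto simp: simps)
  qed auto
  also have "\<dots> = (\<Sum>v\<in>merges n u2 u3. \<Sum>w\<in>merges m u1 v. ?x (Pack w))"
    by (rule sum.Sigma[symmetric]) auto
  also have "\<dots> = (\<Sum>v\<in>merges n u2 u3. Poly_Mapping.lookup (?D x) (Pack u1, Pack v))"
    by (rule sum.cong) (simp_all add: lookup_hcomult_WQSym[OF sep23])
  also have "\<dots> = (\<Sum>_\<in>{()}. \<Sum>v\<in>merges n u2 u3. Poly_Mapping.lookup (?D x) (Pack u1, Pack v))"
    by simp
  also have "\<dots> = Poly_Mapping.lookup (tmap id ?D (?D x)) abc"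
    unfolding abc a b c
    by (rule lookup_tmap[OF lookup_id lookup_hcomult_WQSym[OF sep'], symmetric])
  finally show "Poly_Mapping.lookup (tassoc (tmap ?D id (?D x))) abc =
      Poly_Mapping.lookup (tmap id ?D (?D x)) abc" .
qed

lemma is_coalgebra_WQSym: "is_coalgebra WQSym"
  unfolding is_coalgebra_def
proof (intro conjI allI WQSym_coassoc)
  show "Vector_Spaces.linear qscale (*) (hcounit WQSym)"
    unfolding hcounit_WQSym[abs_def] by (rule linear_coefficient)
  fix x
  show "lin_ext (\<lambda>(a, b). qscale (hcounit WQSym (bvec a)) (bvec b)) (hcomult WQSym x) = x"
  proof (rule poly_mapping_eqI)
    fix w
    obtain u where u: "w = Pack u" "\<forall>x\<in>set u. 0 < x" by (rule shifted_word)
    then have "separated 0 [] u" by (simp add: separated_def)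
    from lookup_hcomult_WQSym[OF this, of x] u
    show "Poly_Mapping.lookup (lin_ext (\<lambda>(a, b). qscale (hcounit WQSym (bvec a)) (bvec b))
        (hcomult WQSym x)) w = Poly_Mapping.lookup x w"
      by (simp add: hcounit_WQSym lookup_counit_left merges_Nil_left)
  qed
  show "lin_ext (\<lambda>(a, b). qscale (hcounit WQSym (bvec b)) (bvec a)) (hcomult WQSym x) = x"
  proof (rule poly_mapping_eqI)
    fix w
    obtain m where m: "\<forall>x\<in>set (word_of w). x \<le> m" using word_bound by blast
    then have "separated m (word_of w) []" by (simp add: separated_def)
    from lookup_hcomult_WQSym[OF this, of x] m
    show "Poly_Mapping.lookup (lin_ext (\<lambda>(a, b). qscale (hcounit WQSym (bvec b)) (bvec a))
        (hcomult WQSym x)) w = Poly_Mapping.lookup x w"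
      by (simp add: hcounit_WQSym lookup_counit_right merges_Nil_right)
  qed
qed simp

text \<open>
  Cutting a shuffle of \<open>u1\<close> and \<open>u2\<close> in two amounts to cutting \<open>u1\<close> and \<open>u2\<close> in two and choosing a
  shuffle of the two beginnings and one of the two ends.
\<close>

lemma WQSym_compatible:
  "hcomult WQSym (hmult WQSym (x \<otimes> y)) =
    tmap (hmult WQSym) (hmult WQSym) (tmiddle (hcomult WQSym x \<otimes> hcomult WQSym y))"
proof (rule WQSym_tens_eqI)
  let ?m = "hmult WQSym" and ?D = "hcomult WQSym"
  let ?x = "\<lambda>u. Poly_Mapping.lookup x (Pack u)" and ?y = "\<lambda>u. Poly_Mapping.lookup y (Pack u)"
  fix m u1 u2 assume sep: "separated m u1 u2"
  let ?B = "SIGMA k:splits u1 \<times> splits u2.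
    merges m (fst (fst k)) (fst (snd k)) \<times> merges m (snd (fst k)) (snd (snd k))"
  let ?lo = "filter (\<lambda>x. x \<le> m)" and ?hi = "filter (\<lambda>x. m < x)"
  have sep_parts: "separated m (fst i) (fst j)" "separated m (snd i) (snd j)"
    if "i \<in> splits u1" "j \<in> splits u2" for i j
    using that sep by (auto simp: splits_def separated_def)
  have "Poly_Mapping.lookup (?D (?m (x \<otimes> y))) (Pack u1, Pack u2) =
      (\<Sum>v\<in>merges m u1 u2. \<Sum>i\<in>splits v. ?x (fst i) * ?y (snd i))"
    by (simp add: lookup_hcomult_WQSym[OF sep] lookup_hmult_WQSym lookup_tens)
  also have "\<dots> = (\<Sum>(v, i)\<in>(SIGMA v:merges m u1 u2. splits v). ?x (fst i) * ?y (snd i))"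
    by (rule sum.Sigma) auto
  also have "\<dots> = (\<Sum>(k, i)\<in>?B. ?x (fst i) * ?y (snd i))"
    by (rule sum.reindex_bij_witness[of _ "\<lambda>(k, p, q). (p @ q, p, q)"
          "\<lambda>(v, p, q). (((?lo p, ?lo q), (?hi p, ?hi q)), p, q)"])
       (auto simp: splits_def merges_def)
  also have "\<dots> = (\<Sum>k\<in>splits u1 \<times> splits u2. \<Sum>i\<in>merges m (fst (fst k)) (fst (snd k)) \<times>
      merges m (snd (fst k)) (snd (snd k)). ?x (fst i) * ?y (snd i))"
    by (rule sum.Sigma[symmetric]) auto
  also have "\<dots> = (\<Sum>i\<in>splits u1. \<Sum>j\<in>splits u2.
      (\<Sum>p\<in>merges m (fst i) (fst j). ?x p) * (\<Sum>q\<in>merges m (snd i) (snd j). ?y q))"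
    by (simp add: sum.cartesian_product' sum_product)
  also have "\<dots> = (\<Sum>i\<in>splits u1. \<Sum>j\<in>splits u2. Poly_Mapping.lookup (tmiddle (?D x \<otimes> ?D y))
      ((Pack (fst i), Pack (snd i)), (Pack (fst j), Pack (snd j))))"
    by (intro sum.cong refl)
       (simp add: lookup_tmiddle lookup_tens lookup_hcomult_WQSym[OF sep_parts(1)]
         lookup_hcomult_WQSym[OF sep_parts(2)])
  also have "\<dots> = Poly_Mapping.lookup (tmap ?m ?m (tmiddle (?D x \<otimes> ?D y))) (Pack u1, Pack u2)"
    by (rule lookup_tmap[OF lookup_hmult_WQSym lookup_hmult_WQSym, symmetric])
  finally show "Poly_Mapping.lookup (?D (?m (x \<otimes> y))) (Pack u1, Pack u2) =
      Poly_Mapping.lookup (tmap ?m ?m (tmiddle (?D x \<otimes> ?D y))) (Pack u1, Pack u2)" .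
qed

lemma is_bialgebra_WQSym: "is_bialgebra WQSym"
  unfolding is_bialgebra_def
proof (intro conjI allI is_algebra_WQSym is_coalgebra_WQSym WQSym_compatible)
  show "hcomult WQSym (hunit WQSym) = hunit WQSym \<otimes> hunit WQSym"
  proof (rule WQSym_tens_eqI)
    fix m u1 u2 assume sep: "separated m u1 u2"
    have "[] \<in> merges m u1 u2 \<longleftrightarrow> u1 = [] \<and> u2 = []"
      by (auto simp: merges_def)
    then have "(\<Sum>v\<in>merges m u1 u2. of_bool (v = [])) = (of_bool (u1 = [] \<and> u2 = []) :: rat)"
      by (simp add: of_bool_def sum.delta)
    then show "Poly_Mapping.lookup (hcomult WQSym (hunit WQSym)) (Pack u1, Pack u2) =
        Poly_Mapping.lookup (hunit WQSym \<otimes> hunit WQSym) (Pack u1, Pack u2)"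
      unfolding hunit_WQSym lookup_hcomult_WQSym[OF sep] tens_bvec lookup_bvec prod.inject Pack_eq_Nil .
  qed
  show "hcounit WQSym (hmult WQSym (x \<otimes> y)) = hcounit WQSym x * hcounit WQSym y" for x y
    by (simp add: hcounit_WQSym lookup_hmult_WQSym lookup_tens)
  show "hcounit WQSym (hunit WQSym) = 1"
    by (simp add: hcounit_WQSym hunit_WQSym lookup_bvec)
qed

lemma is_hopf_algebra_WQSym: "is_hopf_algebra WQSym"
proof (rule graded_connected_hopf[where deg = wlen and e = "Pack []"])
  fix a b c assume *: "(b, c) \<in> Poly_Mapping.keys (hcomult WQSym (bvec a))"
  obtain m u1 u2 where bc: "b = Pack u1" "c = Pack u2" and sep: "separated m u1 u2"
    by (rule separated_words)
  have "(\<Sum>v\<in>merges m u1 u2. of_bool (a = Pack v)) \<noteq> (0 :: rat)"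
    using * by (simp add: in_keys_iff bc lookup_wcoprod[OF sep])
  then obtain v where "v \<in> merges m u1 u2" "a = Pack v"
    by (metis (mono_tags, lifting) of_bool_eq_0_iff sum.neutral)
  then show "wlen b + wlen c = wlen a" by (simp add: bc length_merges)
next
  show "a = Pack []" if "wlen a = 0" for a
    using that by (metis Pack_word_of length_0_conv wlen_def)
qed (simp_all add: is_bialgebra_WQSym hunit_WQSym hcounit_WQSym)

section \<open>Proper colorings\<close>

text \<open>
  Colorings as words, in which the letter \<open>x - 1\<close> (counted from 0) is the color of the vertex
  \<open>x\<close>. As edges have two elements, injectivity on an edge says that its ends get different colors;
  in this form the condition is transported along relabellings. The words are arbitrary, so that
  it applies to the parts of a packed word.
\<close>

definition proper :: "indexed_graph \<Rightarrow> nat list \<Rightarrow> bool" where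
  "proper G u \<longleftrightarrow> length u = gsize G \<and> (\<forall>e\<in>edges G. inj_on (\<lambda>x. u ! (x - 1)) e)"

lemma nth_pred_in_set: "x \<in> {1..length u} \<Longrightarrow> u ! (x - 1) \<in> set u"
  by (intro nth_mem) auto

lemma map_nth_pred: "map (\<lambda>x. u ! (x - 1)) [1..<length u + 1] = u"
  by (rule nth_equalityI) (auto simp: nth_append simp del: upt_Suc)

lemma nth_map_positions: "x \<in> {1..n} \<Longrightarrow> map f [1..<n + 1] ! (x - 1) = f x"
  using nth_map_upt[of "x - 1" "n + 1" 1 f] by (auto simp del: upt_Suc)

text \<open>
  Whether a coloring is proper depends only on which vertices have equal colors. So a word and its packed word
  can be exchanged.
\<close>

lemma proper_map_inj:
  assumes "inj_on f (set u)"
  shows "proper G (map f u) \<longleftrightarrow> proper G u"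
proof -
  have "inj_on (\<lambda>x. map f u ! (x - 1)) e \<longleftrightarrow> inj_on (\<lambda>x. u ! (x - 1)) e"
    if "e \<in> edges G" "length u = gsize G" for e
  proof -
    have e: "x \<in> {1..length u}" if "x \<in> e" for x
      using edgesD[OF \<open>e \<in> edges G\<close>] \<open>length u = gsize G\<close> that by (auto simp: verts_def)
    have "inj_on (\<lambda>x. map f u ! (x - 1)) e \<longleftrightarrow> inj_on (\<lambda>x. f (u ! (x - 1))) e"
    proof (rule inj_on_cong)
      fix x assume "x \<in> e"
      then have "x - 1 < length u" using e[of x] by auto
      then show "map f u ! (x - 1) = f (u ! (x - 1))" by simp
    qed
    also have "\<dots> \<longleftrightarrow> inj_on (\<lambda>x. u ! (x - 1)) e"
      unfolding inj_on_def using assms nth_pred_in_set e by (metis inj_on_eq_iff)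
    finally show ?thesis .
  qed
  then show ?thesis by (auto simp: proper_def)
qed

lemma proper_Pack: "proper G (word_of (Pack u)) \<longleftrightarrow> proper G u"
  unfolding word_of_Pack Pack_list_def
  by (rule proper_map_inj, rule strict_mono_on_imp_inj_on[OF rank_strict_mono]) simp

lemma inj_on_edge_iff:
  assumes "e \<in> edges G"
  shows "inj_on f e \<longleftrightarrow> (\<forall>x y. e = {x, y} \<longrightarrow> f x \<noteq> f y)"
proof -
  obtain a b where "e = {a, b}" "a \<noteq> b"
    using edgesD[OF assms] by (auto simp: card_2_iff)
  then show ?thesis by (auto simp: doubleton_eq_iff)
qed

lemma coloring_words: "coloring_word G ` PVC G = {w. proper G (word_of w)}"
proof (intro equalityI subsetI)
  fix w assume "w \<in> coloring_word G ` PVC G"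
  then obtain f where f: "f \<in> PVC G" "w = coloring_word G f" by blast
  have "inj_on (\<lambda>x. word_of w ! (x - 1)) e" if e: "e \<in> edges G" for e
  proof -
    have "word_of w ! (x - 1) = f x" if "x \<in> e" for x
    proof -
      have "x \<in> {1..gsize G}" using edgesD[OF e] that by (auto simp: verts_def)
      then show ?thesis unfolding f(2) word_of_coloring_word[OF f(1)]
        by (rule nth_map_positions)
    qed
    then have "inj_on (\<lambda>x. word_of w ! (x - 1)) e \<longleftrightarrow> inj_on f e" by (rule inj_on_cong)
    then show ?thesis using f(1) e by (auto simp: inj_on_edge_iff[OF e] PVC_def)
  qed
  then show "w \<in> {w. proper G (word_of w)}"
    using word_of_coloring_word[OF f(1)] by (simp add: proper_def f(2) del: upt_Suc)
next
  fix w assume "w \<in> {w. proper G (word_of w)}"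
  then have w: "proper G (word_of w)" by simp
  define f where "f = restrict (\<lambda>x. word_of w ! (x - 1)) (verts G)"
  have len: "length (word_of w) = gsize G" using w by (simp add: proper_def)
  have V: "verts G = set [1..<length (word_of w) + 1]" using len by (auto simp: verts_def)
  have map_f: "map f [1..<gsize G + 1] = word_of w"
    using map_nth_pred[of "word_of w"] len by (simp add: f_def V del: upt_Suc set_upt cong: map_cong)
  have "f ` verts G = {1..wmax w}"
    using arg_cong[OF map_f, of set] by (simp add: V len set_word_of del: upt_Suc set_upt)
  moreover have "f x \<noteq> f y" if "{x, y} \<in> edges G" for x y
    using w that edgesD[OF that] inj_on_edge_iff[OF that, of "\<lambda>x. word_of w ! (x - 1)"]
    by (auto simp: proper_def f_def)
  ultimately have "f \<in> PVC G" by (auto simp: PVC_def f_def)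
  moreover have "coloring_word G f = w"
    by (simp only: coloring_word_def map_f word_of_inverse)
  ultimately show "w \<in> coloring_word G ` PVC G" by blast
qed

lemma inj_on_coloring_word: "inj_on (coloring_word G) (PVC G)"
proof
  fix f g assume f: "f \<in> PVC G" and g: "g \<in> PVC G" and eq: "coloring_word G f = coloring_word G g"
  have "map f [1..<gsize G + 1] = map g [1..<gsize G + 1]"
    using word_of_coloring_word[OF f] word_of_coloring_word[OF g] eq by simp
  then have "f x = g x" if "x \<in> verts G" for x
    using that by (auto simp: verts_def simp del: upt_Suc)
  then show "f = g" using f g by (intro extensionalityI[of f "verts G"]) (auto simp: PVC_def)
qed

lemma qlinear_F_chr [simp]: "qlinear F_chr"
  by (simp add: F_chr_def)

lemma lookup_F_chr_bvec: "Poly_Mapping.lookup (F_chr (bvec G)) w = of_bool (proper G (word_of w))"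
proof -
  have "Poly_Mapping.lookup (F_chr (bvec G)) w = (\<Sum>f\<in>PVC G. of_bool (coloring_word G f = w))"
    by (simp add: F_chr_def lookup_sum lookup_bvec)
  also have "\<dots> = (\<Sum>v\<in>coloring_word G ` PVC G. of_bool (v = w))"
    by (simp only: sum.reindex[OF inj_on_coloring_word] o_def)
  also have "\<dots> = of_bool (w \<in> coloring_word G ` PVC G)"
    using finite_PVC by (simp add: of_bool_def sum.delta)
  also have "\<dots> = of_bool (proper G (word_of w))" by (simp only: coloring_words mem_Collect_eq)
  finally show ?thesis .
qed

lemma lookup_F_chr_Pack: "Poly_Mapping.lookup (F_chr (bvec G)) (Pack u) = of_bool (proper G u)"
  by (simp only: lookup_F_chr_bvec proper_Pack)

section \<open>Colorings are compatible with products and coproducts\<close>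

lemma proper_gprod:
  assumes "length p = gsize G"
  shows "proper (gprod G H) (p @ q) \<longleftrightarrow> proper G p \<and> proper H q"
proof -
  let ?sh = "\<lambda>x. x + gsize G"
  have "inj_on (\<lambda>x. (p @ q) ! (x - 1)) e \<longleftrightarrow> inj_on (\<lambda>x. p ! (x - 1)) e" if "e \<in> edges G" for e
    by (rule inj_on_cong) (use edgesD[OF that] assms in \<open>force simp: verts_def nth_append\<close>)
  moreover have "inj_on (\<lambda>x. (p @ q) ! (x - 1)) (?sh ` e) \<longleftrightarrow> inj_on (\<lambda>x. q ! (x - 1)) e"
    if "e \<in> edges H" for e
  proof -
    have "inj_on (\<lambda>x. (p @ q) ! (x - 1)) (?sh ` e) \<longleftrightarrow> inj_on (\<lambda>x. (p @ q) ! (?sh x - 1)) e"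
      using comp_inj_on_iff[of ?sh e "\<lambda>x. (p @ q) ! (x - 1)"] by (simp add: o_def)
    also have "\<dots> \<longleftrightarrow> inj_on (\<lambda>x. q ! (x - 1)) e"
    proof (rule inj_on_cong)
      fix x assume "x \<in> e"
      then have "1 \<le> x" using edgesD[OF that] by (auto simp: verts_def)
      then have "?sh x - 1 = length p + (x - 1)" using assms by simp
      then show "(p @ q) ! (?sh x - 1) = q ! (x - 1)" by (simp only: nth_append_length_plus)
    qed
    finally show ?thesis .
  qed
  ultimately show ?thesis
    using assms by (auto simp: proper_def gsize_gprod edges_gprod)
qed

lemma F_chr_mult: "F_chr (hmult HGraph t) = hmult WQSym (tmap F_chr F_chr t)"
proof (rule qlinear_pair_eqI[of "\<lambda>t. F_chr (hmult HGraph t)"])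
  show "F_chr (hmult HGraph (bvec (G, H))) = hmult WQSym (tmap F_chr F_chr (bvec (G, H)))" for G H
  proof (rule WQSym_eqI)
    fix u
    let ?n = "gsize G"
    let ?C = "proper G (take ?n u) \<and> proper H (drop ?n u)"
    have *: "proper G (take n u) \<and> proper H (drop n u) \<longleftrightarrow> n = ?n \<and> ?C" if "n \<le> length u" for n
      using that by (auto simp: proper_def)
    have "Poly_Mapping.lookup (hmult WQSym (tmap F_chr F_chr (bvec (G, H)))) (Pack u) =
        (\<Sum>n\<le>length u. of_bool (proper G (take n u) \<and> proper H (drop n u)))"
      by (simp add: lookup_hmult_WQSym sum_splits lookup_tens lookup_F_chr_Pack of_bool_conj)
    also have "\<dots> = (\<Sum>n\<le>length u. if n = ?n then of_bool ?C else 0)"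
      by (rule sum.cong) (simp_all only: * atMost_iff, simp)
    also have "\<dots> = of_bool (?n \<le> length u \<and> ?C)" by (simp add: sum.delta)
    also have "?n \<le> length u \<and> ?C \<longleftrightarrow> proper (gprod G H) u"
    proof (cases "?n \<le> length u")
      case True
      then show ?thesis using proper_gprod[of "take ?n u" G H "drop ?n u"] by simp
    qed (auto simp: proper_def gsize_gprod)
    finally show "Poly_Mapping.lookup (F_chr (hmult HGraph (bvec (G, H)))) (Pack u) =
        Poly_Mapping.lookup (hmult WQSym (tmap F_chr F_chr (bvec (G, H)))) (Pack u)"
      by (simp add: lookup_F_chr_Pack)
  qed
qed (simp_all add: qlinear_comp[OF qlinear_F_chr] qlinear_comp[OF hmult_WQSym(1)])

text \<open>
  Both lists are strictly increasing, and ranks map \<open>I\<close> onto an initial interval.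
\<close>

lemma map_rank_filter:
  assumes "I \<subseteq> {1..n}"
  shows "map (rank I) (filter (\<lambda>x. x \<in> I) [1..<n + 1]) = [1..<card I + 1]"
proof (rule sorted_distinct_set_unique)
  let ?L = "filter (\<lambda>x. x \<in> I) [1..<n + 1]"
  have fin: "finite I" using assms by (rule finite_subset) simp
  have set: "set ?L = I" using assms by auto
  have "sorted_wrt (<) ?L" by (rule sorted_wrt_filter) (rule sorted_wrt_upt)
  then have "sorted_wrt (<) (map (rank I) ?L)"
    unfolding sorted_wrt_map
    by (rule sorted_wrt_mono_rel[rotated]) (use rank_strict_mono[OF fin] set in \<open>auto dest: strict_mono_onD\<close>)
  then show "sorted (map (rank I) ?L)" "distinct (map (rank I) ?L)"
    by (simp_all only: strict_sorted_iff)
  show "set (map (rank I) ?L) = set [1..<card I + 1]"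
    using rank_bij[OF fin] unfolding set_map set by (auto simp: bij_betw_def)
qed (simp_all only: sorted_upt distinct_upt)

text \<open>
  The letters of a filtered word sit at the ranks of the positions that they come from.
\<close>

lemma filter_eq_iff_rank:
  assumes "I \<subseteq> {1..n}" "\<And>x. x \<in> {1..n} \<Longrightarrow> P (h x) \<longleftrightarrow> x \<in> I"
  shows "filter P (map h [1..<n + 1]) = u \<longleftrightarrow>
    length u = card I \<and> (\<forall>x\<in>I. h x = u ! (rank I x - 1))"
proof -
  let ?L = "filter (\<lambda>x. x \<in> I) [1..<n + 1]"
  have L: "map (rank I) ?L = [1..<card I + 1]" by (rule map_rank_filter[OF assms(1)])
  then have len: "length ?L = card I" by (metis add_diff_cancel_right' length_map length_upt)
  have rank: "rank I (?L ! k) = k + 1" if "k < card I" for k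
  proof -
    have "rank I (?L ! k) = map (rank I) ?L ! k" using that len by simp
    then show ?thesis using that unfolding L by (simp del: upt_Suc)
  qed
  have set: "set ?L = I" using assms(1) by auto
  have "filter P (map h [1..<n + 1]) = map h ?L"
    unfolding filter_map by (rule arg_cong[of _ _ "map h"], rule filter_cong) (use assms(2) in auto)
  then have "filter P (map h [1..<n + 1]) = u \<longleftrightarrow>
      length u = card I \<and> (\<forall>k<card I. h (?L ! k) = u ! k)"
    using len by (auto simp: list_eq_iff_nth_eq simp del: upt_Suc)
  also have "(\<forall>k<card I. h (?L ! k) = u ! k) \<longleftrightarrow> (\<forall>x\<in>I. h x = u ! (rank I x - 1))"
  proof
    assume *: "\<forall>k<card I. h (?L ! k) = u ! k"
    show "\<forall>x\<in>I. h x = u ! (rank I x - 1)"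
    proof
      fix x assume "x \<in> I"
      then obtain k where "k < card I" "x = ?L ! k" using set len by (metis in_set_conv_nth)
      then show "h x = u ! (rank I x - 1)" using * rank by simp
    qed
  next
    assume *: "\<forall>x\<in>I. h x = u ! (rank I x - 1)"
    show "\<forall>k<card I. h (?L ! k) = u ! k"
    proof (intro allI impI)
      fix k assume k: "k < card I"
      then have "?L ! k \<in> I" using set len nth_mem by metis
      with * rank[OF k] show "h (?L ! k) = u ! k" by simp
    qed
  qed
  finally show ?thesis .
qed

lemma merges_iff_rank:
  assumes "I \<subseteq> {1..n}" "length v = n" "\<And>x. x \<in> {1..n} \<Longrightarrow> v ! (x - 1) \<le> m \<longleftrightarrow> x \<in> I"
  shows "v \<in> merges m u1 u2 \<longleftrightarrow>
    length u1 = card I \<and> (\<forall>x\<in>I. v ! (x - 1) = u1 ! (rank I x - 1)) \<and>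
    length u2 = card ({1..n} - I) \<and> (\<forall>x\<in>{1..n} - I. v ! (x - 1) = u2 ! (rank ({1..n} - I) x - 1))"
proof -
  let ?h = "\<lambda>x. v ! (x - 1)"
  have v: "map ?h [1..<n + 1] = v" using map_nth_pred[of v] assms(2) by simp
  have lo: "filter (\<lambda>x. x \<le> m) v = u1 \<longleftrightarrow>
      length u1 = card I \<and> (\<forall>x\<in>I. ?h x = u1 ! (rank I x - 1))"
    using filter_eq_iff_rank[of I n "\<lambda>x. x \<le> m" ?h u1] assms(1,3) unfolding v by blast
  have "m < ?h x \<longleftrightarrow> x \<in> {1..n} - I" if "x \<in> {1..n}" for x
    using assms(3)[OF that] that by auto
  then have hi: "filter (\<lambda>x. m < x) v = u2 \<longleftrightarrow>
      length u2 = card ({1..n} - I) \<and> (\<forall>x\<in>{1..n} - I. ?h x = u2 ! (rank ({1..n} - I) x - 1))"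
    using filter_eq_iff_rank[of "{1..n} - I" n "\<lambda>x. m < x" ?h u2] unfolding v by blast
  show ?thesis unfolding merges_def mem_Collect_eq lo hi by blast
qed

text \<open>A shuffle of separated words is encoded by the set of positions that its small letters take.\<close>

definition low_positions :: "nat \<Rightarrow> nat list \<Rightarrow> nat set" where
  "low_positions m v = {x \<in> {1..length v}. v ! (x - 1) \<le> m}"

lemma bij_betw_low_positions:
  assumes "separated m u1 u2"
  defines "n \<equiv> length u1 + length u2"
  shows "bij_betw (low_positions m) (merges m u1 u2) {I. I \<subseteq> {1..n} \<and> card I = length u1}"
  unfolding bij_betw_def
proof (intro conjI equalityI subsetI)
  have len: "length v = n" if "v \<in> merges m u1 u2" for v
    using length_merges[OF that] by (simp add: n_def)
  have low: "low_positions m v \<subseteq> {1..n}" "\<And>x. x \<in> {1..n} \<Longrightarrow> v ! (x - 1) \<le> m \<longleftrightarrow> x \<in> low_positions m v"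
    if "v \<in> merges m u1 u2" for v
    using len[OF that] by (auto simp: low_positions_def)
  have rank: "length u1 = card (low_positions m v)"
    "\<And>x. x \<in> low_positions m v \<Longrightarrow> v ! (x - 1) = u1 ! (rank (low_positions m v) x - 1)"
    "\<And>x. x \<in> {1..n} - low_positions m v \<Longrightarrow>
      v ! (x - 1) = u2 ! (rank ({1..n} - low_positions m v) x - 1)"
    if "v \<in> merges m u1 u2" for v
    using merges_iff_rank[OF low(1) len low(2), OF that that that, of u1 u2] that by blast+
  show "inj_on (low_positions m) (merges m u1 u2)"
  proof
    fix v v' assume *: "v \<in> merges m u1 u2" "v' \<in> merges m u1 u2" "low_positions m v = low_positions m v'"
    have "v ! (x - 1) = v' ! (x - 1)" if "x \<in> {1..n}" for x
      using rank(2,3)[OF *(1), of x] rank(2,3)[OF *(2), of x] *(3) that by (cases "x \<in> low_positions m v") auto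
    then have "map (\<lambda>x. v ! (x - 1)) [1..<n + 1] = map (\<lambda>x. v' ! (x - 1)) [1..<n + 1]"
      by (intro map_cong) auto
    then show "v = v'"
      using map_nth_pred[of v] map_nth_pred[of v'] unfolding len[OF *(1)] len[OF *(2)] by (simp only:)
  qed
  fix I
  {
    assume "I \<in> low_positions m ` merges m u1 u2"
    then obtain v where v: "v \<in> merges m u1 u2" "I = low_positions m v" by blast
    then show "I \<in> {I. I \<subseteq> {1..n} \<and> card I = length u1}"
      using rank(1)[OF v(1)] len[OF v(1)] by (auto simp: low_positions_def)
  }
  assume "I \<in> {I. I \<subseteq> {1..n} \<and> card I = length u1}"
  then have I: "I \<subseteq> {1..n}" "card I = length u1" by auto
  let ?J = "{1..n} - I"
  have finI: "finite I" using I(1) by (rule finite_subset) simp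
  have J: "card ?J = length u2"
    using I finI by (simp add: card_Diff_subset n_def)
  \<comment> \<open>the inverse map: fill the positions in \<open>I\<close> with \<open>u1\<close> and the others with \<open>u2\<close>, in order\<close>
  define h where "h x = (if x \<in> I then u1 ! (rank I x - 1) else u2 ! (rank ?J x - 1))" for x
  define v where "v = map h [1..<n + 1]"
  have v: "length v = n" "\<And>x. x \<in> {1..n} \<Longrightarrow> v ! (x - 1) = h x"
    using nth_map_positions[of _ n h] by (simp_all add: v_def del: upt_Suc)
  have "rank I x \<in> {1..length u1}" if "x \<in> I" for x
    using rank_bij[OF finI] that unfolding I(2) by (auto simp: bij_betw_def)
  then have lo: "u1 ! (rank I x - 1) \<le> m" if "x \<in> I" for x
    using that nth_pred_in_set assms(1) by (metis separated_def)
  have "rank ?J x \<in> {1..length u2}" if "x \<in> ?J" for x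
    using rank_bij[of ?J] that unfolding J by (auto simp: bij_betw_def)
  then have hi: "m < u2 ! (rank ?J x - 1)" if "x \<in> ?J" for x
    using that nth_pred_in_set assms(1) by (metis separated_def)
  have thr: "v ! (x - 1) \<le> m \<longleftrightarrow> x \<in> I" if "x \<in> {1..n}" for x
    using v(2)[OF that] lo[of x] hi[of x] that by (auto simp: h_def)
  have "v \<in> merges m u1 u2"
  proof (subst merges_iff_rank[of I n v m u1 u2, OF I(1) v(1) thr], assumption, intro conjI ballI)
    show "v ! (x - 1) = u1 ! (rank I x - 1)" if "x \<in> I" for x
      using v(2)[of x] that I(1) unfolding h_def by (simp only: if_True subset_iff)
    show "v ! (x - 1) = u2 ! (rank ?J x - 1)" if "x \<in> ?J" for x
      using v(2)[of x] that unfolding h_def by (simp only: Diff_iff if_False simp_thms)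
  qed (use I J in simp_all)
  moreover have "low_positions m v = I"
    using thr I(1) v(1) by (auto simp: low_positions_def)
  ultimately show "I \<in> low_positions m ` merges m u1 u2" by blast
qed

lemma proper_grestr:
  assumes "I \<subseteq> verts G"
  shows "proper (grestr G I) u \<longleftrightarrow> length u = card I \<and>
    (\<forall>e\<in>edges G. e \<subseteq> I \<longrightarrow> inj_on (\<lambda>x. u ! (rank I x - 1)) e)"
proof -
  have "inj_on (rank I) I" using rank_bij_verts[OF assms] by (simp add: bij_betw_def)
  then have "inj_on (\<lambda>x. u ! (x - 1)) (rank I ` e) \<longleftrightarrow> inj_on (\<lambda>x. u ! (rank I x - 1)) e"
    if "e \<subseteq> I" for e
    using comp_inj_on_iff[of "rank I" e "\<lambda>x. u ! (x - 1)"] that by (simp add: o_def inj_on_subset)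
  then show ?thesis using assms by (auto simp: proper_def gsize_grestr edges_grestr)
qed

text \<open>
  No condition is lost at an edge between the two parts, as its two ends have letters from separated ranges.
\<close>

lemma proper_merge:
  assumes sep: "separated m u1 u2" and v: "v \<in> merges m u1 u2" and len: "length v = gsize G"
  defines "I \<equiv> low_positions m v"
  shows "proper G v \<longleftrightarrow> proper (grestr G I) u1 \<and> proper (grestr G (verts G - I)) u2"
proof -
  let ?J = "verts G - I" and ?h = "\<lambda>x. v ! (x - 1)"
  have I: "I \<subseteq> verts G" and thr: "\<And>x. x \<in> verts G \<Longrightarrow> ?h x \<le> m \<longleftrightarrow> x \<in> I"
    using len by (auto simp: I_def low_positions_def verts_def)
  have r: "length u1 = card I" "\<And>x. x \<in> I \<Longrightarrow> ?h x = u1 ! (rank I x - 1)"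
    "length u2 = card ?J" "\<And>x. x \<in> ?J \<Longrightarrow> ?h x = u2 ! (rank ?J x - 1)"
    using merges_iff_rank[OF I[unfolded verts_def] len thr[unfolded verts_def], of u1 u2] v
    unfolding verts_def by blast+
  have I_iff: "inj_on (\<lambda>x. u1 ! (rank I x - 1)) e \<longleftrightarrow> inj_on ?h e" if "e \<subseteq> I" for e
    by (rule inj_on_cong) (use r(2) that in \<open>simp add: subset_iff\<close>)
  have J_iff: "inj_on (\<lambda>x. u2 ! (rank ?J x - 1)) e \<longleftrightarrow> inj_on ?h e" if "e \<subseteq> ?J" for e
    by (rule inj_on_cong) (use r(4) that in \<open>simp add: subset_iff\<close>)
  have crossing: "inj_on ?h e" if e: "e \<in> edges G" and parts: "\<not> e \<subseteq> I" "\<not> e \<subseteq> ?J" for e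
  proof -
    obtain x y where xy: "x \<in> e" "x \<in> I" "y \<in> e" "y \<in> ?J"
      using parts edgesD[OF e] by blast
    then have "e = {x, y}" using edgesD[OF e] by (auto simp: card_2_iff)
    moreover have "?h x \<noteq> ?h y" using thr[of x] thr[of y] xy I by auto
    ultimately show ?thesis by auto
  qed
  have "proper G v \<longleftrightarrow> (\<forall>e\<in>edges G. e \<subseteq> I \<longrightarrow> inj_on ?h e) \<and> (\<forall>e\<in>edges G. e \<subseteq> ?J \<longrightarrow> inj_on ?h e)"
    using len crossing unfolding proper_def by blast
  also have "\<dots> \<longleftrightarrow> proper (grestr G I) u1 \<and> proper (grestr G ?J) u2"
    using r(1,3) I_iff J_iff unfolding proper_grestr[OF I] proper_grestr[OF Diff_subset] by blast
  finally show ?thesis .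
qed

text \<open>
  With the encoding of shuffles by sets of positions, both sides count the sets \<open>I\<close> for which \<open>u1\<close> and
  \<open>u2\<close> are proper colorings of the restrictions of \<open>G\<close> to \<open>I\<close> and its complement. If the lengths of
  \<open>u1\<close> and \<open>u2\<close> do not add up to the number of vertices, both sides vanish.
\<close>

lemma F_chr_comult: "hcomult WQSym (F_chr x) = tmap F_chr F_chr (hcomult HGraph x)"
proof (rule qlinear_eqI[of "\<lambda>x. hcomult WQSym (F_chr x)"])
  fix G
  show "hcomult WQSym (F_chr (bvec G)) = tmap F_chr F_chr (hcomult HGraph (bvec G))"
  proof (rule WQSym_tens_eqI)
    fix m u1 u2 assume sep: "separated m u1 u2"
    let ?V = "verts G" and ?n = "length u1 + length u2"
    let ?c = "\<lambda>I. of_bool (proper (grestr G I) u1 \<and> proper (grestr G (?V - I)) u2) :: rat"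
    have rhs: "Poly_Mapping.lookup (tmap F_chr F_chr (hcomult HGraph (bvec G))) (Pack u1, Pack u2) =
        (\<Sum>I\<in>Pow ?V. ?c I)"
      by (simp add: gcoprod_eq qlinear_sum lookup_sum lookup_tens lookup_F_chr_Pack of_bool_conj)
    have lhs: "Poly_Mapping.lookup (hcomult WQSym (F_chr (bvec G))) (Pack u1, Pack u2) =
        (\<Sum>v\<in>merges m u1 u2. of_bool (proper G v))"
      by (simp only: lookup_hcomult_WQSym[OF sep] lookup_F_chr_Pack)
    show "Poly_Mapping.lookup (hcomult WQSym (F_chr (bvec G))) (Pack u1, Pack u2) =
        Poly_Mapping.lookup (tmap F_chr F_chr (hcomult HGraph (bvec G))) (Pack u1, Pack u2)"
    proof (cases "?n = gsize G")
      case True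
      then have "(\<Sum>v\<in>merges m u1 u2. of_bool (proper G v)) = (\<Sum>v\<in>merges m u1 u2. ?c (low_positions m v))"
        by (intro sum.cong refl arg_cong[of _ _ of_bool] proper_merge[OF sep]) (auto simp: length_merges)
      also have "\<dots> = (\<Sum>I | I \<subseteq> {1..?n} \<and> card I = length u1. ?c I)"
        by (rule sum.reindex_bij_betw[OF bij_betw_low_positions[OF sep]])
      also have "\<dots> = (\<Sum>I\<in>Pow ?V. ?c I)"
        by (rule sum.mono_neutral_left) (auto simp: verts_def True proper_def gsize_grestr)
      finally show ?thesis unfolding lhs rhs .
    next
      case False
      have "card I + card (?V - I) = gsize G" if "I \<subseteq> ?V" for I
        using card_mono[of ?V I] that by (simp add: card_Diff_subset finite_subset)
      then have "(\<Sum>I\<in>Pow ?V. ?c I) = 0"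
        using False by (intro sum.neutral) (auto simp: proper_def gsize_grestr)
      moreover have "(\<Sum>v\<in>merges m u1 u2. of_bool (proper G v)) = (0 :: rat)"
        using False by (intro sum.neutral) (auto simp: proper_def length_merges)
      ultimately show ?thesis unfolding lhs rhs by simp
    qed
  qed
qed (simp_all add: qlinear_comp[OF hcomult_WQSym(1)] qlinear_comp[OF qlinear_tmap])

lemma F_chr_unit: "F_chr (hunit HGraph) = hunit WQSym"
  by (rule WQSym_eqI) (simp add: hunit_HGraph hunit_WQSym lookup_F_chr_Pack lookup_bvec proper_def)

lemma proper_Nil_iff: "proper G [] \<longleftrightarrow> G = empty_graph"
proof
  assume "proper G []"
  then have "gsize G = 0" by (simp add: proper_def)
  then show "G = empty_graph" by (simp add: gsize_0_iff)
qed (simp add: proper_def)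

lemma F_chr_counit: "hcounit WQSym (F_chr x) = hcounit HGraph x"
proof -
  have "Poly_Mapping.lookup (F_chr x) (Pack []) = (\<Sum>i\<in>{()}. Poly_Mapping.lookup x empty_graph)"
    by (rule lookup_pullback) (simp_all add: lookup_F_chr_Pack proper_Nil_iff)
  then show ?thesis by (simp add: hcounit_HGraph hcounit_WQSym)
qed

lemma F_chr_mult_tens: "F_chr (hmult HGraph (x \<otimes> y)) = hmult WQSym (F_chr x \<otimes> F_chr y)"
  by (simp add: F_chr_mult tmap_tens)

lemma F_chr_antipode:
  assumes "is_antipode HGraph S" "is_antipode WQSym T"
  shows "F_chr (S x) = T (F_chr x)"
  by (rule bialgebra_morphism_antipode[OF is_bialgebra_HGraph is_bialgebra_WQSym qlinear_F_chr
        F_chr_mult_tens F_chr_unit F_chr_comult F_chr_counit assms])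

lemma is_hopf_morphism_F_chr: "is_hopf_morphism HGraph WQSym F_chr"
  using F_chr_antipode
  by (simp add: is_hopf_morphism_def is_hopf_algebra_HGraph is_hopf_algebra_WQSym F_chr_mult_tens
      F_chr_unit F_chr_comult F_chr_counit)

section \<open>Set partitions\<close>

lemma partition_on_word_partition: "partition_on {1..wlen w} (word_partition w)"
proof (rule partition_onI)
  show "\<Union> (word_partition w) = {1..wlen w}" by (rule Union_word_partition)
  show "disjnt p q" if "p \<in> word_partition w" "q \<in> word_partition w" "p \<noteq> q" for p q
    using that by (auto simp: word_partition_def wpos_def disjnt_def)
  show "{} \<notin> word_partition w"
  proof
    assume "{} \<in> word_partition w"
    then obtain j where "j \<in> set (word_of w)" "wpos w j = {}"
      by (auto simp: word_partition_def set_word_of)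
    then obtain i where "i < wlen w" "word_of w ! i = j" by (auto simp: in_set_conv_nth wlen_def)
    then have "Suc i \<in> wpos w j" by (auto simp: wpos_def)
    with \<open>wpos w j = {}\<close> show False by simp
  qed
qed

text \<open>An edge lies inside a block of the partition of \<open>w\<close> exactly if \<open>w\<close> gives its two ends the same letter.\<close>

lemma proper_iff_IP: "proper G (word_of w) \<longleftrightarrow> word_partition w \<in> IP G"
proof (cases "wlen w = gsize G")
  case True
  let ?h = "\<lambda>x. word_of w ! (x - 1)"
  have "inj_on ?h e \<longleftrightarrow> (\<forall>I\<in>word_partition w. \<not> e \<subseteq> I)" if e: "e \<in> edges G" for e
  proof -
    obtain x y where xy: "e = {x, y}" "x \<noteq> y" "x \<in> {1..wlen w}" "y \<in> {1..wlen w}"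
      using edgesD[OF e] True by (auto simp: card_2_iff verts_def)
    have "?h x \<in> {1..wmax w}"
      using nth_pred_in_set[of x "word_of w"] xy(3) unfolding set_word_of wlen_def .
    then have "(\<exists>I\<in>word_partition w. e \<subseteq> I) \<longleftrightarrow> ?h x = ?h y"
      using xy by (auto simp: word_partition_def wpos_def)
    then show ?thesis using xy by auto
  qed
  then show ?thesis
    using True partition_on_word_partition[of w] by (auto simp: proper_def IP_def verts_def wlen_def)
next
  case False
  have "wlen w = gsize G" if "partition_on (verts G) (word_partition w)"
    using partition_onD1[OF that] Union_word_partition[of w] by (metis card_atLeastAtMost card_verts diff_Suc_1)
  with False show ?thesis by (auto simp: proper_def IP_def wlen_def)
qed

lemma lookup_W: "Poly_Mapping.lookup (W P) w = of_bool (word_partition w = P)"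
  using finite_word_partition[of P] by (simp add: W_def lookup_sum lookup_bvec of_bool_def sum.delta)

lemma F_chr_eq_sum_W: "F_chr (bvec G) = (\<Sum>P\<in>IP G. W P)"
proof (rule poly_mapping_eqI)
  show "Poly_Mapping.lookup (F_chr (bvec G)) w = Poly_Mapping.lookup (\<Sum>P\<in>IP G. W P) w" for w
    using finite_IP[of G]
    by (simp add: lookup_F_chr_bvec proper_iff_IP lookup_sum lookup_W of_bool_def sum.delta')
qed

lemma IP_subset_set_partitions: "IP G \<subseteq> set_partitions"
  by (auto simp: IP_def set_partitions_def verts_def)

text \<open>Number the blocks arbitrarily and give each position the number of its block.\<close>

lemma set_partition_of_word:
  assumes "P \<in> set_partitions"
  obtains w where "word_partition w = P"
proof -
  obtain n where P: "partition_on {1..n} P" using assms by (auto simp: set_partitions_def)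
  have "finite P" by (rule finite_elements[OF _ P]) simp
  then obtain b where b: "bij_betw b {1..card P} P" using ex_bij_betw_nat_finite_1 by blast
  have union_b: "\<Union> (b ` {1..card P}) = {1..n}"
    unfolding bij_betw_imp_surj_on[OF b] by (rule partition_onD1[OF P, symmetric])
  then have "\<exists>j. j \<in> {1..card P} \<and> i \<in> b j" if "i \<in> {1..n}" for i
    using that by blast
  then obtain c where c: "c i \<in> {1..card P}" "i \<in> b (c i)" if "i \<in> {1..n}" for i by metis
  have c_eq: "c i = j" if "i \<in> b j" "j \<in> {1..card P}" for i j
  proof -
    have i: "i \<in> {1..n}" using that union_b by blast
    have "b (c i) \<in> P" "b j \<in> P" using c[OF i] that b by (auto simp: bij_betw_def)
    then have "b (c i) = b j"
      using partition_onD2[OF P] c[OF i] that by (auto simp: disjoint_def)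
    then show ?thesis by (rule inj_onD[OF bij_betw_imp_inj_on[OF b] _ c(1)[OF i] that(2)])
  qed
  have mem: "i \<in> {1..n}" if "i \<in> b j" "j \<in> {1..card P}" for i j
    using that union_b by blast
  let ?u = "map c [1..<n + 1]"
  have set_u: "set ?u = {1..card P}"
  proof (intro equalityI subsetI)
    fix j assume j: "j \<in> {1..card P}"
    then have "b j \<noteq> {}"
      using bij_betw_apply[OF b] partition_onD3[OF P] by metis
    then obtain i where "i \<in> b j" by blast
    with j show "j \<in> set ?u" using c_eq[of i j] mem[of i j] by (auto simp del: upt_Suc)
  qed (use c in auto)
  define w where "w = PWord ?u"
  have w: "word_of w = ?u" unfolding w_def by (rule PWord_inverse) (use set_u in blast)
  have len: "wlen w = n" by (simp add: wlen_def w)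
  have letters: "{1..wmax w} = {1..card P}" using set_word_of[of w] set_u by (simp only: w)
  have blocks: "wpos w j = b j" if "j \<in> {1..card P}" for j
  proof -
    have "word_of w ! (i - 1) = c i" if "i \<in> {1..n}" for i
      unfolding w using that by (rule nth_map_positions)
    then have "wpos w j = {i \<in> {1..n}. c i = j}" by (auto simp: wpos_def len)
    also have "\<dots> = b j" using that c c_eq mem by blast
    finally show ?thesis .
  qed
  have "word_partition w = b ` {1..card P}"
    unfolding word_partition_def letters by (rule image_cong[OF refl blocks])
  then show thesis using b that by (simp add: bij_betw_def)
qed

lemma W_eq_iff:
  assumes "P \<in> set_partitions"
  shows "W P = W Q \<longleftrightarrow> P = Q"
proof
  obtain w where "word_partition w = P" using assms by (rule set_partition_of_word)
  moreover assume "W P = W Q"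
  ultimately show "P = Q" using lookup_W[of P w] lookup_W[of Q w] by simp
qed simp

text \<open>The elements \<open>W P\<close> are nonzero, and their supports are disjoint as each word has one partition.\<close>

lemma is_basis_of_W: "is_basis_of set_partitions W WSym"
  unfolding is_basis_of_def
proof (intro conjI)
  show "inj_on W set_partitions" by (rule inj_onI) (simp add: W_eq_iff)
  show "qvec.span (W ` set_partitions) = WSym" by (simp add: WSym_def)
  show "qvec.independent (W ` set_partitions)"
    unfolding qvec.independent_explicit_module
  proof (intro allI impI)
    fix t u v
    assume t: "finite t" "t \<subseteq> W ` set_partitions" "(\<Sum>v\<in>t. qscale (u v) v) = 0" "v \<in> t"
    then obtain P where P: "P \<in> set_partitions" "v = W P" by blast
    obtain w where w: "word_partition w = P" using P(1) by (rule set_partition_of_word)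
    have "Poly_Mapping.lookup v' w = of_bool (v' = v)" if "v' \<in> t" for v'
    proof -
      obtain Q where "v' = W Q" using t(2) \<open>v' \<in> t\<close> by blast
      then show ?thesis using W_eq_iff[OF P(1), of Q] by (auto simp: lookup_W w P(2))
    qed
    then have "Poly_Mapping.lookup (\<Sum>v\<in>t. qscale (u v) v) w = (\<Sum>v'\<in>t. if v' = v then u v else 0)"
      unfolding lookup_sum by (intro sum.cong) auto
    then show "u v = 0" using t by (simp add: sum.delta)
  qed
qed

section \<open>The image of the chromatic morphism\<close>

text \<open>
  The set of pairs inside blocks encodes a partition of a given set. Refinement becomes inclusion of these sets,
  and the number of pairs is the measure for induction along refinement.
\<close>

definition block_pairs :: "nat set set \<Rightarrow> nat set set" where
  "block_pairs P = {e. card e = 2 \<and> (\<exists>I\<in>P. e \<subseteq> I)}"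

lemma finite_block_pairs:
  assumes "partition_on A P" "finite A"
  shows "finite (block_pairs P)"
  by (rule finite_subset[of _ "Pow A"]) (use assms in \<open>auto simp: block_pairs_def partition_on_def\<close>)

lemma partition_subset_if_block_pairs_eq:
  assumes P: "partition_on A P" and Q: "partition_on A Q" and eq: "block_pairs P = block_pairs Q"
  shows "P \<subseteq> Q"
proof
  have grow: "I \<subseteq> J" if "partition_on A Q'" "block_pairs P' = block_pairs Q'" "I \<in> P'" "J \<in> Q'"
    "x \<in> I" "x \<in> J" for P' Q' I J x
  proof
    fix y assume "y \<in> I"
    show "y \<in> J"
    proof (cases "y = x")
      case False
      then have "{x, y} \<in> block_pairs P'"
        using that(3,5) \<open>y \<in> I\<close> by (auto simp: block_pairs_def)
      then have "{x, y} \<in> block_pairs Q'" unfolding that(2) .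
      then obtain J' where J': "J' \<in> Q'" "{x, y} \<subseteq> J'" unfolding block_pairs_def by blast
      with that(4,6) have "J' = J"
        using disjointD[OF partition_onD2[OF that(1)], of J' J] by blast
      with J'(2) show ?thesis by simp
    qed (simp add: that(6))
  qed
  fix I assume I: "I \<in> P"
  then have "I \<noteq> {}" using partition_onD3[OF P] by metis
  with I obtain x where x: "x \<in> I" "x \<in> A"
    using partition_onD1[OF P] by blast
  then obtain J where J: "J \<in> Q" "x \<in> J" using partition_onD1[OF Q] by blast
  have "I \<subseteq> J" "J \<subseteq> I"
    using grow[OF Q eq I J(1) x(1) J(2)] grow[OF P eq[symmetric] J(1) I J(2) x(1)] by simp_all
  then have "I = J" by (rule subset_antisym)
  then show "I \<in> Q" using J(1) by simp
qed

text \<open>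
  The complete multipartite graph with the blocks of \<open>P\<close> as its parts: its independent partitions are the
  refinements of \<open>P\<close>.
\<close>

definition multipartite :: "nat \<Rightarrow> nat set set \<Rightarrow> indexed_graph" where
  "multipartite n P = IGraph (n, {e. e \<subseteq> {1..n} \<and> card e = 2} - block_pairs P)"

lemma graph_of_multipartite:
  "graph_of (multipartite n P) = (n, {e. e \<subseteq> {1..n} \<and> card e = 2} - block_pairs P)"
  unfolding multipartite_def by (rule IGraph_inverse) auto

lemmas gsize_multipartite = graph_of_eq(1)[OF graph_of_multipartite]
  and edges_multipartite = graph_of_eq(2)[OF graph_of_multipartite]

lemma IP_multipartite:
  "Q \<in> IP (multipartite n P) \<longleftrightarrow> partition_on {1..n} Q \<and> block_pairs Q \<subseteq> block_pairs P"
proof -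
  have "(\<forall>I\<in>Q. \<forall>e\<in>edges (multipartite n P). \<not> e \<subseteq> I) \<longleftrightarrow> block_pairs Q \<subseteq> block_pairs P"
    if "partition_on {1..n} Q"
  proof -
    have "I \<subseteq> {1..n}" if "I \<in> Q" for I
      using that \<open>partition_on {1..n} Q\<close> by (auto simp: partition_on_def)
    then show ?thesis unfolding edges_multipartite block_pairs_def by blast
  qed
  then show ?thesis by (auto simp: IP_def verts_def gsize_multipartite)
qed

lemma subspace_range_F_chr: "qvec.subspace (range F_chr)"
proof (rule qvec.subspaceI)
  show "0 \<in> range F_chr" by (rule range_eqI[of _ _ 0]) (simp add: qlinear_0)
  show "x + y \<in> range F_chr" if "x \<in> range F_chr" "y \<in> range F_chr" for x y
    using that by (auto simp flip: qlinear_add[OF qlinear_F_chr])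
  show "qscale c x \<in> range F_chr" if "x \<in> range F_chr" for c x
    using that by (auto simp flip: qlinear_scale[OF qlinear_F_chr])
qed

text \<open>
  The sum of \<open>W Q\<close> over the refinements \<open>Q\<close> of \<open>P\<close> is in the image, and a proper refinement
  has fewer pairs inside its blocks.
\<close>

lemma W_in_range_F_chr: "partition_on {1..n} P \<Longrightarrow> W P \<in> range F_chr"
proof (induction "card (block_pairs P)" arbitrary: P rule: less_induct)
  case less
  note sub = subspace_range_F_chr
  let ?G = "multipartite n P"
  have P: "P \<in> IP ?G" using less.prems by (simp add: IP_multipartite)
  have "W Q \<in> range F_chr" if "Q \<in> IP ?G - {P}" for Q
  proof -
    have Q: "partition_on {1..n} Q" "block_pairs Q \<subseteq> block_pairs P" "Q \<noteq> P"
      using that by (auto simp: IP_multipartite)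
    moreover have "block_pairs Q \<noteq> block_pairs P"
      using Q partition_subset_if_block_pairs_eq[OF Q(1) less.prems]
        partition_subset_if_block_pairs_eq[OF less.prems Q(1)] by auto
    ultimately have "card (block_pairs Q) < card (block_pairs P)"
      using finite_block_pairs[OF less.prems] by (intro psubset_card_mono) auto
    then show ?thesis using Q(1) by (rule less.hyps)
  qed
  then have "(\<Sum>Q\<in>IP ?G - {P}. W Q) \<in> range F_chr" by (intro qvec.subspace_sum[OF sub])
  moreover have "F_chr (bvec ?G) = W P + (\<Sum>Q\<in>IP ?G - {P}. W Q)"
    unfolding F_chr_eq_sum_W by (rule sum.remove[OF finite_IP P])
  then have "W P = F_chr (bvec ?G) - (\<Sum>Q\<in>IP ?G - {P}. W Q)" by simp
  ultimately show ?case using qvec.subspace_diff[OF sub rangeI] by simp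
qed

lemma range_F_chr: "range F_chr = WSym"
proof
  have basis: "F_chr (bvec G) \<in> WSym" for G
    unfolding F_chr_eq_sum_W WSym_def
    by (intro qvec.span_sum qvec.span_base imageI) (use IP_subset_set_partitions in blast)
  have "F_chr x \<in> WSym" for x
    unfolding qlinear_expansion[OF qlinear_F_chr, of x] WSym_def
    by (intro qvec.span_sum qvec.span_scale) (rule basis[unfolded WSym_def])
  then show "range F_chr \<subseteq> WSym" by blast
  note subspace_range_F_chr
  moreover have "W ` set_partitions \<subseteq> range F_chr"
    using W_in_range_F_chr by (auto simp: set_partitions_def)
  ultimately show "WSym \<subseteq> range F_chr" unfolding WSym_def by (intro qvec.span_minimal)
qed

text \<open>Every closure property is inherited by the image of a Hopf algebra morphism.\<close>

lemma is_hopf_subalgebra_WSym: "is_hopf_subalgebra WQSym WSym"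
  unfolding is_hopf_subalgebra_def
proof (intro conjI ballI is_hopf_algebra_WQSym)
  show "qvec.subspace WSym" by (simp add: WSym_def)
  show "hunit WQSym \<in> WSym" by (metis F_chr_unit range_F_chr rangeI)
  show "hmult WQSym (x \<otimes> y) \<in> WSym" if "x \<in> WSym" "y \<in> WSym" for x y
    using that unfolding range_F_chr[symmetric] by (auto simp flip: F_chr_mult_tens)
  show "hcomult WQSym x \<in> qvec.span {y \<otimes> z | y z. y \<in> WSym \<and> z \<in> WSym}"
    if mem: "x \<in> WSym" for x
  proof -
    obtain x' where x: "x = F_chr x'" using mem unfolding range_F_chr[symmetric] by blast
    have "tmap F_chr F_chr (bvec p) \<in> {y \<otimes> z | y z. y \<in> WSym \<and> z \<in> WSym}" for p
      unfolding range_F_chr[symmetric] by (cases p) auto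
    then show ?thesis
      unfolding x F_chr_comult qlinear_expansion[OF qlinear_tmap[of F_chr F_chr], of "hcomult HGraph x'"]
      by (intro qvec.span_sum qvec.span_scale qvec.span_base)
  qed
  obtain S T where S: "is_antipode HGraph S" and T: "is_antipode WQSym T"
    using is_hopf_algebra_HGraph is_hopf_algebra_WQSym by (auto simp: is_hopf_algebra_def)
  have "T ` WSym \<subseteq> WSym"
    unfolding range_F_chr[symmetric] by (auto simp flip: F_chr_antipode[OF S T])
  with T show "\<exists>S. is_antipode WQSym S \<and> S ` WSym \<subseteq> WSym" by blast
qed

text \<open>Cocommutativity passes from graphs to the image of \<open>F_chr\<close>.\<close>

lemma cocommutative_on_WSym: "cocommutative_on WQSym WSym"
  unfolding cocommutative_on_def
proof
  fix x assume "x \<in> WSym"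
  then obtain x' where x: "x = F_chr x'" unfolding range_F_chr[symmetric] by blast
  have tswap_tens: "tswap (y \<otimes> z) = z \<otimes> y" for y z :: "packed_word \<Rightarrow>\<^sub>0 rat"
    by (rule bilinear_eqI[of "\<lambda>y z. tswap (y \<otimes> z)"])
       (simp_all add: qlinear_compose qlinear_tens_left qlinear_tens_right)
  have "tswap (tmap F_chr F_chr t) = tmap F_chr F_chr (tswap t)" for t
    by (rule qlinear_pair_eqI[of "\<lambda>t. tswap (tmap F_chr F_chr t)"])
       (simp_all add: qlinear_compose tswap_tens)
  moreover have "tswap (hcomult HGraph x') = hcomult HGraph x'"
    by (rule qlinear_eqI[of "\<lambda>x. tswap (hcomult HGraph x)"])
       (simp_all add: qlinear_compose gcoprod_cocommutative)
  ultimately show "tswap (hcomult WQSym x) = hcomult WQSym x"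
    by (simp add: x F_chr_comult)
qed

theorem theorem4p5:
  shows "is_basis_of set_partitions W WSym \<and>
         is_hopf_subalgebra WQSym WSym \<and>
         cocommutative_on WQSym WSym \<and>
         is_hopf_morphism HGraph WQSym F_chr \<and>
         range F_chr = WSym \<and>
         (\<forall>G. F_chr (bvec G) = (\<Sum>P\<in>IP G. W P))"
  using is_basis_of_W is_hopf_subalgebra_WSym cocommutative_on_WSym is_hopf_morphism_F_chr
    range_F_chr F_chr_eq_sum_W by blast

end
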